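(* For $1\le i\le k$ define $D_i$ on left $\mathcal A_\hbar[x_1,\dots,x_n]$-linear combinations of the elements $\overline T_\nu$ ($\nu\subseteq(n-k)^k$) by $D_i(g\,\overline T_\mu)=g\,D_i(\overline T_\mu)$ for $g\in\mathcal A_\hbar[x_1,\dots,x_n]$ and $$D_i(\overline T_\mu)=x_{\mu_i+k+1-i}\,\overline T_\mu+\sum_\lambda\bigl(\hbar-(p-q)x_{\mathtt h(\mu/\lambda)}\bigr)p^{\operatorname{ht}(\mu/\lambda)-1}q^{\operatorname{wd}(\mu/\lambda)-1}\,\overline T_\lambda,$$ the sum over $\lambda\subseteq(n-k)^k$ such that $\mu/\lambda$ is a ribbon with head in row $i$. Then for $\mu\subseteq(n-k)^k$ and $0\le r\le k$, in $\widehat H_n$, $$\overline T_\mu\,e_r(x_1,\dots,x_k)=\sum_{1\le i_1<\cdots<i_r\le k}D_{i_1}\bigl(D_{i_2}(\cdots D_{i_r}(\overline T_\mu)\cdots)\bigr).$$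
   Context: $\mathcal A_\hbar=\mathbb Q[p,q,\hbar]$; $\widehat H_n$ is generated by $T_1,\dots,T_{n-1},x_1,\dots,x_n$ with $(T_i+p)(T_i-q)=0$, braid relations, $x_ix_j=x_jx_i$, $T_ix_j=x_jT_i$ ($j\ne i,i+1$), $T_ix_i=x_{i+1}T_i+(\hbar-(p-q)x_i)$, $T_ix_{i+1}=x_iT_i-(\hbar-(p-q)x_i)$. $\overline T_i=T_i+p-q$, $\overline T_w$ via reduced words. For $\nu\subseteq(n-k)^k$, $w_\nu$ is the permutation with $w_\nu(k+1-i)=\nu_i+k+1-i$ ($1\le i\le k$), increasing on $\{k+1,\dots,n\}$. $[m]=(p^m-q^m)/(p-q)$, $[m]!=\prod_{j\le m}[j]$, $d=\binom k2+\binom{n-k}2$, $\Sigma^n_k=\frac1{[k]![n-k]!}\sum_{v\in S_k\times S_{n-k}}q^{d-\ell(v)}\overline T_v$ (scalars extended to invert $[k]![n-k]!$), $\overline T_\nu=\overline T_{w_\nu}\Sigma^n_k$. Ribbon: nonempty connected skew shape $\mu/\lambda$ with no $2\times2$ square; head = top-right box; $\operatorname{ht},\operatorname{wd}$ = numbers of rows, columns; head in row $i$ gives $\mathtt h(\mu/\lambda)=\mu_i+k+1-i$. *)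

theory Defs
  imports Main "HOL-Combinatorics.Permutations"
begin

section \<open>Scalars and the defining relations of the affine Hecke algebra\<close>

definition central :: "'a::ring_1 \<Rightarrow> bool" where
  "central a \<longleftrightarrow> (\<forall>y. a * y = y * a)"

text \<open>Elements T 1 .. T (n-1), x 1 .. x n of a ring satisfying the defining relations
  of the affine Hecke algebra, with central scalars p, q, h (h stands for hbar).\<close>
definition hecke_rels ::
  "nat \<Rightarrow> 'a::ring_1 \<Rightarrow> 'a \<Rightarrow> 'a \<Rightarrow> (nat \<Rightarrow> 'a) \<Rightarrow> (nat \<Rightarrow> 'a) \<Rightarrow> bool" where
  "hecke_rels n p q h T x \<longleftrightarrow>
     central p \<and> central q \<and> central h \<and>
     (\<forall>i\<in>{1..<n}. (T i + p) * (T i - q) = 0) \<and>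
     (\<forall>i. 1 \<le> i \<and> i + 1 < n \<longrightarrow> T i * T (i+1) * T i = T (i+1) * T i * T (i+1)) \<and>
     (\<forall>i\<in>{1..<n}. \<forall>j\<in>{1..<n}. i + 1 < j \<longrightarrow> T i * T j = T j * T i) \<and>
     (\<forall>i\<in>{1..n}. \<forall>j\<in>{1..n}. x i * x j = x j * x i) \<and>
     (\<forall>i\<in>{1..<n}. \<forall>j\<in>{1..n}. j \<noteq> i \<and> j \<noteq> i + 1 \<longrightarrow> T i * x j = x j * T i) \<and>
     (\<forall>i\<in>{1..<n}. T i * x i = x (i+1) * T i + (h - (p - q) * x i)) \<and>
     (\<forall>i\<in>{1..<n}. T i * x (i+1) = x i * T i - (h - (p - q) * x i))"

text \<open>Quantum integers [m] = (p^m - q^m)/(p - q), written as the polynomial they are.\<close>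
definition qint :: "'a::ring_1 \<Rightarrow> 'a \<Rightarrow> nat \<Rightarrow> 'a" where
  "qint p q m = (\<Sum>j<m. p ^ j * q ^ (m - 1 - j))"

definition qfact :: "'a::ring_1 \<Rightarrow> 'a \<Rightarrow> nat \<Rightarrow> 'a" where
  "qfact p q m = prod_list (map (qint p q) [1..<m+1])"

section \<open>Permutations, length, reduced words\<close>

definition inv_count :: "nat \<Rightarrow> (nat \<Rightarrow> nat) \<Rightarrow> nat" where
  "inv_count n w = card {(i, j). 1 \<le> i \<and> i < j \<and> j \<le> n \<and> w j < w i}"

definition sref :: "nat \<Rightarrow> nat \<Rightarrow> nat" where
  "sref i = (\<lambda>j. if j = i then Suc i else if j = Suc i then i else j)"

definition perm_of_word :: "nat list \<Rightarrow> nat \<Rightarrow> nat" where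
  "perm_of_word ws = foldr (\<lambda>i f. sref i \<circ> f) ws id"

definition reduced_word :: "nat \<Rightarrow> (nat \<Rightarrow> nat) \<Rightarrow> nat list \<Rightarrow> bool" where
  "reduced_word n w ws \<longleftrightarrow>
     set ws \<subseteq> {1..<n} \<and> perm_of_word ws = w \<and> length ws = inv_count n w"

text \<open>Tbar_w = Tbar_{i_1} ... Tbar_{i_l} for a reduced word w = s_{i_1} ... s_{i_l},
  where Tbar_i = T_i + p - q.\<close>
definition Tbar :: "nat \<Rightarrow> 'a::ring_1 \<Rightarrow> 'a \<Rightarrow> (nat \<Rightarrow> 'a) \<Rightarrow> (nat \<Rightarrow> nat) \<Rightarrow> 'a" where
  "Tbar n p q T w = prod_list (map (\<lambda>i. T i + p - q) (SOME ws. reduced_word n w ws))"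

definition young_sub :: "nat \<Rightarrow> nat \<Rightarrow> (nat \<Rightarrow> nat) set" where
  "young_sub n k = {v. v permutes {1..n} \<and> v ` {1..k} = {1..k}}"

definition dd :: "nat \<Rightarrow> nat \<Rightarrow> nat" where
  "dd n k = (k choose 2) + ((n - k) choose 2)"

text \<open>Sigma^n_k, where cinv is the inverse of [k]! [n-k]!.\<close>
definition Sigma_nk :: "nat \<Rightarrow> nat \<Rightarrow> 'a::ring_1 \<Rightarrow> 'a \<Rightarrow> (nat \<Rightarrow> 'a) \<Rightarrow> 'a \<Rightarrow> 'a" where
  "Sigma_nk n k p q T cinv =
     cinv * (\<Sum>v\<in>young_sub n k. q ^ (dd n k - inv_count n v) * Tbar n p q T v)"

section \<open>Partitions in the k x (n-k) box\<close>

text \<open>A partition nu with at most k parts, each at most n-k, is a function with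
  nu 1 >= ... >= nu k, nu i <= n - k, and nu i = 0 for i = 0 or i > k.\<close>
definition box_parts :: "nat \<Rightarrow> nat \<Rightarrow> (nat \<Rightarrow> nat) set" where
  "box_parts n k = {\<nu>. (\<forall>i. (i = 0 \<or> k < i) \<longrightarrow> \<nu> i = 0) \<and>
                        (\<forall>i. 1 \<le> i \<and> i < k \<longrightarrow> \<nu> (Suc i) \<le> \<nu> i) \<and>
                        (\<forall>i. \<nu> i \<le> n - k)}"

text \<open>w_nu (k+1-i) = nu_i + k+1-i for 1 <= i <= k, increasing on {k+1..n}
  (taking the remaining values), identity outside {1..n}.\<close>
definition wperm :: "nat \<Rightarrow> nat \<Rightarrow> (nat \<Rightarrow> nat) \<Rightarrow> nat \<Rightarrow> nat" where
  "wperm n k \<nu> j =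
     (if 1 \<le> j \<and> j \<le> k then \<nu> (k + 1 - j) + j
      else if k < j \<and> j \<le> n then
        sorted_list_of_set ({1..n} - {\<nu> i + k + 1 - i | i. i \<in> {1..k}}) ! (j - k - 1)
      else j)"

definition TbarP ::
  "nat \<Rightarrow> nat \<Rightarrow> 'a::ring_1 \<Rightarrow> 'a \<Rightarrow> (nat \<Rightarrow> 'a) \<Rightarrow> 'a \<Rightarrow> (nat \<Rightarrow> nat) \<Rightarrow> 'a" where
  "TbarP n k p q T cinv \<nu> = Tbar n p q T (wperm n k \<nu>) * Sigma_nk n k p q T cinv"

section \<open>Ribbons\<close>

definition skew :: "(nat \<Rightarrow> nat) \<Rightarrow> (nat \<Rightarrow> nat) \<Rightarrow> (nat \<times> nat) set" where
  "skew \<mu> la = {(i, j). la i < j \<and> j \<le> \<mu> i}"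

definition box_adj :: "nat \<times> nat \<Rightarrow> nat \<times> nat \<Rightarrow> bool" where
  "box_adj a b \<longleftrightarrow>
     (fst a = fst b \<and> (snd b = Suc (snd a) \<or> snd a = Suc (snd b))) \<or>
     (snd a = snd b \<and> (fst b = Suc (fst a) \<or> fst a = Suc (fst b)))"

definition is_ribbon :: "(nat \<Rightarrow> nat) \<Rightarrow> (nat \<Rightarrow> nat) \<Rightarrow> bool" where
  "is_ribbon \<mu> la \<longleftrightarrow>
     (\<forall>i. la i \<le> \<mu> i) \<and> skew \<mu> la \<noteq> {} \<and>
     (\<forall>a\<in>skew \<mu> la. \<forall>b\<in>skew \<mu> la.
        (a, b) \<in> {(c, d). c \<in> skew \<mu> la \<and> d \<in> skew \<mu> la \<and> box_adj c d}\<^sup>*) \<and>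
     \<not> (\<exists>i j. (i, j) \<in> skew \<mu> la \<and> (Suc i, j) \<in> skew \<mu> la \<and>
              (i, Suc j) \<in> skew \<mu> la \<and> (Suc i, Suc j) \<in> skew \<mu> la)"

text \<open>Row of the head (top-right box): the top row of the ribbon.\<close>
definition head_row :: "(nat \<Rightarrow> nat) \<Rightarrow> (nat \<Rightarrow> nat) \<Rightarrow> nat" where
  "head_row \<mu> la = Min (fst ` skew \<mu> la)"

definition ribbon_ht :: "(nat \<Rightarrow> nat) \<Rightarrow> (nat \<Rightarrow> nat) \<Rightarrow> nat" where
  "ribbon_ht \<mu> la = card (fst ` skew \<mu> la)"

definition ribbon_wd :: "(nat \<Rightarrow> nat) \<Rightarrow> (nat \<Rightarrow> nat) \<Rightarrow> nat" where
  "ribbon_wd \<mu> la = card (snd ` skew \<mu> la)"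

text \<open>h(mu/lambda) = mu_i + k + 1 - i, where i is the row of the head.\<close>
definition ribbon_h :: "nat \<Rightarrow> (nat \<Rightarrow> nat) \<Rightarrow> (nat \<Rightarrow> nat) \<Rightarrow> nat" where
  "ribbon_h k \<mu> la = \<mu> (head_row \<mu> la) + k + 1 - head_row \<mu> la"

section \<open>The operators D_i on formal combinations\<close>

text \<open>A left A[x]-linear combination sum_nu c(nu) Tbar_nu is represented by its
  coefficient function c.  Dop i c is the coefficient function of D_i applied to it.\<close>
definition Dop ::
  "nat \<Rightarrow> nat \<Rightarrow> 'a::ring_1 \<Rightarrow> 'a \<Rightarrow> 'a \<Rightarrow> (nat \<Rightarrow> 'a) \<Rightarrow> nat \<Rightarrow>
   ((nat \<Rightarrow> nat) \<Rightarrow> 'a) \<Rightarrow> ((nat \<Rightarrow> nat) \<Rightarrow> 'a)" where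
  "Dop n k p q h x i c = (\<lambda>la.
     c la * x (la i + k + 1 - i) +
     (\<Sum>\<mu>\<in>{\<mu>\<in>box_parts n k. is_ribbon \<mu> la \<and> head_row \<mu> la = i}.
        c \<mu> * ((h - (p - q) * x (ribbon_h k \<mu> la)) *
               p ^ (ribbon_ht \<mu> la - 1) * q ^ (ribbon_wd \<mu> la - 1))))"

definition evalP ::
  "nat \<Rightarrow> nat \<Rightarrow> 'a::ring_1 \<Rightarrow> 'a \<Rightarrow> (nat \<Rightarrow> 'a) \<Rightarrow> 'a \<Rightarrow> ((nat \<Rightarrow> nat) \<Rightarrow> 'a) \<Rightarrow> 'a" where
  "evalP n k p q T cinv c = (\<Sum>\<nu>\<in>box_parts n k. c \<nu> * TbarP n k p q T cinv \<nu>)"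

end

theory Submission
  imports Defs
begin

text \<open>Encode a partition \<nu> by the set S of the k numbers \<nu>_i + k + 1 - i.  Removing a ribbon with
  head in row i replaces the i-th largest element s of S by a smaller number t outside S, with
  coefficient p to the number of elements of S between t and s, times q to the number of
  non-elements between them.  Since the rows are processed from the bottom up, the right-hand side
  is a sum over r-subsets of S in which each selected element s, in increasing order, either stays
  (factor x_s) or jumps down (factor h - (p - q) x_s).

  The symmetrizer commutes with e_r and the left action of Tbar_a on the elements Tbar_S is
  explicit, so the claim follows by induction on S from the initial set {1..k}, where no jump is
  possible.  If a is in S and a + 1 is not, then Tbar_a Tbar_S is the element of the set S' in which
  a is replaced by a + 1.  Left multiplication by Tbar_a commutes with the jumps of all elements
  other than a, while Tbar_a x_a = x_{a+1} Tbar_a + (h - (p - q) x_{a+1}) and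
  Tbar_a (h - (p - q) x_a) = (h - (p - q) x_{a+1}) T_a turn the contributions of a into those of a + 1,
  the extra term accounting for the jump of a + 1 to a.\<close>

section \<open>Length and reduced words in the symmetric group\<close>

text \<open>Both sides are evaluated in an arbitrary ring whose elements satisfy the relations,
  while \<open>D_i\<close> acts on coefficient functions. As \<open>D_i\<close> is left linear, the
  coefficient created by the innermost operator stands leftmost; hence \<open>expand\<close> treats
  the smallest listed element first. The obstacle: after some jumps the current set \<open>U\<close>
  is no longer the original one, and the elements still to be treated sit above holes and landed
  particles. So the lemmas on \<open>Tb a\<close> concern lists inside a general \<open>U\<close>,
  and the action of \<open>Tb a\<close> is recorded by an operator \<open>tau a\<close> on arbitrary
  functions of sets. This operator must commute with every jump starting above \<open>a + 1\<close>,
  including those landing on \<open>a\<close> or \<open>a + 1\<close>; that is the computational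
  core, \<open>jump_tau\<close>. The factor \<open>q\<close> for passing a hole arises thus: once
  \<open>a\<close> has jumped away, neither \<open>a\<close> nor \<open>a + 1\<close> is occupied,
  so \<open>Tb a\<close> acts by \<open>p\<close> and \<open>T a = Tb a - (p - q)\<close> acts by
  \<open>q\<close>.\<close>

lemma sref_eq_transpose: "sref a = Transposition.transpose a (Suc a)"
  by (auto simp: sref_def Transposition.transpose_def)

lemma sref_apply: "sref a j = (if j = a then Suc a else if j = Suc a then a else j)"
  by (simp add: sref_def)

lemma sref_permutes: "a \<in> {1..<n} \<Longrightarrow> sref a permutes {1..n}"
  unfolding sref_eq_transpose by (rule permutes_swap_id) auto

lemma sref_sref [simp]: "sref a (sref a j) = j"
  by (auto simp: sref_apply)

lemma sref_comp_sref [simp]: "sref a \<circ> (sref a \<circ> w) = w"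
  by (auto simp: fun_eq_iff)

lemma sref_comp_permutes: "w permutes {1..n} \<Longrightarrow> a \<in> {1..<n} \<Longrightarrow> (sref a \<circ> w) permutes {1..n}"
  by (rule permutes_compose[OF _ sref_permutes])

lemma inv_sref_comp:
  assumes "w permutes {1..n}" "a \<in> {1..<n}"
  shows "inv (sref a \<circ> w) j = inv w (sref a j)"
proof -
  have "(sref a \<circ> w) (inv w (sref a j)) = j"
    using permutes_inverses[OF assms(1)] by simp
  then show ?thesis
    by (simp only: permutes_inv_eq[OF sref_comp_permutes[OF assms]])
qed

lemma inv_in_interval: "w permutes {1..n} \<Longrightarrow> j \<in> {1..n} \<Longrightarrow> inv w j \<in> {1..n}"
  by (simp only: permutes_in_image[OF permutes_inv])

lemma finite_inversions: "finite {(i, j). 1 \<le> i \<and> i < j \<and> j \<le> (n::nat) \<and> P i j}"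
  by (rule finite_subset[of _ "{1..n} \<times> {1..n}"]) auto

text \<open>Composing with \<open>sref a\<close> on the left exchanges the values \<open>a\<close>
  and \<open>Suc a\<close> and keeps the order of every other pair of values. So exactly one new
  inversion appears, at the positions of these two values.\<close>

lemma inv_count_sref_up:
  assumes w: "w permutes {1..n}" and a: "a \<in> {1..<n}" and asc: "inv w a < inv w (Suc a)"
  shows "inv_count n (sref a \<circ> w) = Suc (inv_count n w)"
proof -
  let ?u = "inv w a" and ?v = "inv w (Suc a)"
  have u: "w i = a \<longleftrightarrow> i = ?u" and v: "w i = Suc a \<longleftrightarrow> i = ?v" for i
    using permutes_inv_eq[OF w] by metis+
  have uv: "?u \<in> {1..n}" "?v \<in> {1..n}"
    using a inv_in_interval[OF w, of a] inv_in_interval[OF w, of "Suc a"] by auto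
  have eq: "{(i, j). 1 \<le> i \<and> i < j \<and> j \<le> n \<and> (sref a \<circ> w) j < (sref a \<circ> w) i}
      = insert (?u, ?v) {(i, j). 1 \<le> i \<and> i < j \<and> j \<le> n \<and> w j < w i}"
  proof -
    have "(sref a (w j) < sref a (w i)) \<longleftrightarrow> (i = ?u \<and> j = ?v) \<or> w j < w i"
      if "i < j" for i j
      using that u[of i] u[of j] v[of i] v[of j] asc unfolding sref_apply by (auto split: if_splits)
    then show ?thesis using uv asc by auto
  qed
  have "(?u, ?v) \<notin> {(i, j). 1 \<le> i \<and> i < j \<and> j \<le> n \<and> w j < w i}"
    using u[of ?u] v[of ?v] by auto
  then show ?thesis
    unfolding inv_count_def eq using finite_inversions by (subst card_insert_disjoint) auto
qed

lemma inv_count_sref_down: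
  assumes w: "w permutes {1..n}" and a: "a \<in> {1..<n}" and desc: "inv w (Suc a) < inv w a"
  shows "inv_count n w = Suc (inv_count n (sref a \<circ> w))"
proof -
  have "inv (sref a \<circ> w) a < inv (sref a \<circ> w) (Suc a)"
    unfolding inv_sref_comp[OF w a] using desc by (simp add: sref_apply)
  from inv_count_sref_up[OF sref_comp_permutes[OF w a] a this] show ?thesis by simp
qed

lemma inv_neq_Suc: "w permutes {1..n} \<Longrightarrow> inv w a \<noteq> inv w (Suc a)"
  using permutes_inv_eq by (metis n_not_Suc_n)

lemma inv_cases:
  assumes "w permutes {1..n}"
  obtains "inv w a < inv w (Suc a)" | "inv w (Suc a) < inv w a"
  using inv_neq_Suc[OF assms, of a] by linarith

section \<open>Reduced words and their uniqueness up to braid relations\<close>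

lemma perm_of_word_simps:
  "perm_of_word [] = id" "perm_of_word (a # ws) = sref a \<circ> perm_of_word ws"
  by (auto simp: perm_of_word_def)

lemma perm_of_word_append: "perm_of_word (us @ vs) = perm_of_word us \<circ> perm_of_word vs"
  by (induction us) (auto simp: comp_assoc perm_of_word_simps)

lemma perm_of_word_permutes: "set ws \<subseteq> {1..<n} \<Longrightarrow> perm_of_word ws permutes {1..n}"
proof (induction ws)
  case Nil
  show ?case unfolding perm_of_word_simps by (rule permutes_id)
next
  case (Cons a ws)
  then show ?case unfolding perm_of_word_simps by (intro sref_comp_permutes) auto
qed

lemma inv_count_id [simp]: "inv_count n id = 0"
  by (simp add: inv_count_def) (auto simp: card_eq_0_iff)

text \<open>Each letter changes the number of inversions by exactly one, up or down.\<close>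

lemma inv_count_perm_of_word: "set ws \<subseteq> {1..<n} \<Longrightarrow> inv_count n (perm_of_word ws) \<le> length ws"
proof (induction ws)
  case (Cons a ws)
  then have w: "perm_of_word ws permutes {1..n}" and a: "a \<in> {1..<n}"
    using perm_of_word_permutes by auto
  have "inv_count n (sref a \<circ> perm_of_word ws) \<le> length (a # ws)"
  proof (rule inv_cases[OF w, of a])
    assume "inv (perm_of_word ws) a < inv (perm_of_word ws) (Suc a)"
    from inv_count_sref_up[OF w a this] Cons show ?thesis by simp
  next
    assume "inv (perm_of_word ws) (Suc a) < inv (perm_of_word ws) a"
    from inv_count_sref_down[OF w a this] Cons.IH Cons.prems show ?thesis by simp
  qed
  then show ?case unfolding perm_of_word_simps .
qed (simp only: perm_of_word_simps inv_count_id)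

text \<open>Monotonicity gives \<open>i \<le> w i\<close> everywhere. A strict inequality anywhere
  would make the sum of the values exceed the sum of the arguments, but a permutation preserves
  it.\<close>

lemma increasing_permutation_eq_id:
  assumes "w permutes {1..n::nat}" and "\<And>i. i \<in> {1..<n} \<Longrightarrow> w i < w (Suc i)"
  shows "w = id"
proof -
  have "w i \<ge> i \<and> w i \<le> n" if "i \<in> {1..n}" for i
  proof
    show "w i \<le> n" using permutes_in_image[OF assms(1)] that by force
    from that show "i \<le> w i"
    proof (induction i)
      case (Suc i)
      show ?case
      proof (cases "i = 0")
        case True
        then show ?thesis using permutes_in_image[OF assms(1)] Suc.prems by force
      next
        case False
        then show ?thesis using Suc assms(2)[of i] by force
      qed
    qed simp
  qed
  then have ge: "\<And>i. i \<in> {1..n} \<Longrightarrow> i \<le> w i" by blast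
  have "w i = i" if "i \<in> {1..n}" for i
  proof (rule ccontr)
    assume "w i \<noteq> i"
    then have "(\<Sum>j\<in>{1..n}. j) < (\<Sum>j\<in>{1..n}. w j)"
      using that ge ge[OF that] by (intro sum_strict_mono_ex1) (auto intro!: bexI[of _ i] simp: order_le_neq_trans)
    moreover have "(\<Sum>j\<in>{1..n}. w j) = (\<Sum>j\<in>{1..n}. j)"
      using sum.permute[OF assms(1), of "\<lambda>j. j"] by (simp add: o_def)
    ultimately show False by simp
  qed
  then show ?thesis
    using permutes_not_in[OF assms(1)] by (auto simp: fun_eq_iff)
qed

text \<open>The last hypothesis says that \<open>a\<close> is a left descent of \<open>w\<close>:
  the value \<open>Suc a\<close> stands before the value \<open>a\<close>. Left descents are
  expressed through \<open>inv w\<close> in this way throughout.\<close>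

lemma reduced_word_Cons:
  assumes "reduced_word n (sref a \<circ> w) ws" "w permutes {1..n}" "a \<in> {1..<n}"
    "inv w (Suc a) < inv w a"
  shows "reduced_word n w (a # ws)"
proof -
  have ws: "set ws \<subseteq> {1..<n}" "perm_of_word ws = sref a \<circ> w"
      "length ws = inv_count n (sref a \<circ> w)"
    using assms(1) by (simp_all only: reduced_word_def)
  have "perm_of_word (a # ws) = w" unfolding perm_of_word_simps ws by simp
  moreover have "length (a # ws) = inv_count n w"
    unfolding inv_count_sref_down[OF assms(2-4)] using ws by simp
  ultimately show ?thesis using ws(1) assms(3) by (simp add: reduced_word_def)
qed

text \<open>Strip left descents one by one. A permutation without left descents has an increasing
  inverse and is therefore the identity.\<close>

lemma reduced_word_exists:
  assumes "w permutes {1..n}"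
  shows "\<exists>ws. reduced_word n w ws"
  using assms
proof (induction "inv_count n w" arbitrary: w)
  case 0
  have "inv w i < inv w (Suc i)" if "i \<in> {1..<n}" for i
  proof (rule inv_cases[OF 0(2), of i])
    assume "inv w (Suc i) < inv w i"
    from inv_count_sref_down[OF 0(2) that this] 0(1) show ?thesis by linarith
  qed
  then have "inv w = id" using increasing_permutation_eq_id[OF permutes_inv[OF 0(2)]] by blast
  then have "w = id" using permutes_inv_inv[OF 0(2)] by simp
  then have "reduced_word n w []"
    by (simp only: reduced_word_def perm_of_word_simps inv_count_id) simp
  then show ?case ..
next
  case (Suc m)
  have "\<exists>a\<in>{1..<n}. inv w (Suc a) < inv w a"
  proof (rule ccontr)
    assume "\<not> ?thesis"
    then have "inv w i < inv w (Suc i)" if "i \<in> {1..<n}" for i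
      using inv_neq_Suc[OF Suc.prems, of i] that by force
    then have "inv w = id" using increasing_permutation_eq_id[OF permutes_inv[OF Suc.prems]] by blast
    then have "w = id" using permutes_inv_inv[OF Suc.prems] by simp
    with Suc show False by simp
  qed
  then obtain a where a: "a \<in> {1..<n}" and d: "inv w (Suc a) < inv w a" by blast
  obtain ws where "reduced_word n (sref a \<circ> w) ws"
    using Suc(1)[OF _ sref_comp_permutes[OF Suc.prems a]] Suc(2)
    unfolding inv_count_sref_down[OF Suc.prems a d] by blast
  then show ?case using reduced_word_Cons[OF _ Suc.prems a d] by blast
qed

text \<open>The tail has at least as many letters as its permutation has inversions. If
  \<open>a\<close> were an ascent of \<open>w\<close>, the tail would have to be longer than the
  whole word.\<close>

lemma reduced_word_ConsD:
  assumes "reduced_word n w (a # ws)"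
  shows "reduced_word n (sref a \<circ> w) ws" "w permutes {1..n}" "a \<in> {1..<n}"
    "inv w (Suc a) < inv w a"
proof -
  have *: "set ws \<subseteq> {1..<n}" "w = sref a \<circ> perm_of_word ws" "Suc (length ws) = inv_count n w"
    and a: "a \<in> {1..<n}"
    using assms by (auto simp: reduced_word_def perm_of_word_simps)
  have w': "perm_of_word ws permutes {1..n}" using perm_of_word_permutes * by blast
  show w: "w permutes {1..n}" using *(2) sref_comp_permutes[OF w' a] by simp
  have le: "inv_count n (sref a \<circ> w) \<le> length ws"
    using inv_count_perm_of_word[OF *(1)] *(2) by simp
  show d: "inv w (Suc a) < inv w a"
    by (rule inv_cases[OF w, of a]) (use inv_count_sref_up[OF w a] le *(3) in auto)
  show "reduced_word n (sref a \<circ> w) ws" "a \<in> {1..<n}"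
    using a *(1) *(3)[unfolded inv_count_sref_down[OF w a d]] unfolding reduced_word_def
    by (auto simp: *(2))
qed

text \<open>Matsumoto's theorem for the symmetric group: two reduced words starting with different
  letters are both compared with one starting with the longest word in these two letters.\<close>
lemma prod_list_reduced_word_unique:
  fixes f :: "nat \<Rightarrow> 'a::monoid_mult"
  assumes braid: "\<And>i. 1 \<le> i \<Longrightarrow> i + 1 < n \<Longrightarrow> f i * f (i+1) * f i = f (i+1) * f i * f (i+1)"
    and comm: "\<And>i j. i \<in> {1..<n} \<Longrightarrow> j \<in> {1..<n} \<Longrightarrow> i + 1 < j \<Longrightarrow> f i * f j = f j * f i"
    and "reduced_word n w us" "reduced_word n w vs"
  shows "prod_list (map f us) = prod_list (map f vs)"
  using assms(3,4)
proof (induction "length us" arbitrary: w us vs)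
  case 0
  then have "length us = 0" "length vs = 0" by (simp_all only: reduced_word_def)
  then show ?case by simp
next
  case (Suc m)
  have "length us = length vs" using Suc.prems by (simp add: reduced_word_def)
  with Suc(2) obtain a us' b vs' where us: "us = a # us'" and vs: "vs = b # vs'"
    by (metis length_Suc_conv)
  have lm: "length us' = m" "length vs' = m" using Suc(2) \<open>length us = length vs\<close> us vs by auto
  note A = reduced_word_ConsD[OF Suc.prems(1)[unfolded us]]
  note B = reduced_word_ConsD[OF Suc.prems(2)[unfolded vs]]
  note w = A(2)
  \<comment> \<open>The induction hypothesis compares a tail with any other reduced word
    \<open>zs\<close> of the same permutation; \<open>zs\<close> is chosen below to pass through the
    longest element generated by the two letters.\<close>
  have IHu: "prod_list (map f us') = prod_list (map f zs)" if "reduced_word n (sref a \<circ> w) zs" for zs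
    by (rule Suc(1)[OF lm(1)[symmetric] A(1) that])
  have IHv: "prod_list (map f vs') = prod_list (map f zs)" if "reduced_word n (sref b \<circ> w) zs" for zs
    by (rule Suc(1)[OF lm(2)[symmetric] B(1) that])
  note sw = sref_comp_permutes
  have far: ?case if cd: "c + 1 < d" "(a, b) = (c, d) \<or> (a, b) = (d, c)" for c d
  proof -
    have c: "c \<in> {1..<n}" "d \<in> {1..<n}" "inv w (Suc c) < inv w c" "inv w (Suc d) < inv w d"
      using cd A B by auto
    note wc = sw[OF w c(1)] and wd = sw[OF w c(2)]
    have eq: "sref d \<circ> (sref c \<circ> w) = sref c \<circ> (sref d \<circ> w)"
      using cd by (auto simp: fun_eq_iff sref_apply)
    obtain zs where zs: "reduced_word n (sref d \<circ> (sref c \<circ> w)) zs"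
      using reduced_word_exists[OF sw[OF wc c(2)]] by blast
    have 1: "reduced_word n (sref c \<circ> w) (d # zs)"
      by (rule reduced_word_Cons[OF zs wc c(2)])
        (use cd c in \<open>simp add: inv_sref_comp[OF w c(1)] sref_apply\<close>)
    have 2: "reduced_word n (sref d \<circ> w) (c # zs)"
      by (rule reduced_word_Cons[OF zs[unfolded eq] wd c(1)])
        (use cd c in \<open>simp add: inv_sref_comp[OF w c(2)] sref_apply\<close>)
    have "f c * (f d * prod_list (map f zs)) = f d * (f c * prod_list (map f zs))"
      using comm[OF c(1,2) cd(1)] by (metis mult.assoc)
    then show ?thesis using cd(2) IHu[of "d # zs"] IHv[of "d # zs"] IHu[of "c # zs"] IHv[of "c # zs"] 1 2 us vs
      by auto
  qed
  have near: ?case if cd: "(a, b) = (c, Suc c) \<or> (a, b) = (Suc c, c)" for c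
  proof -
    let ?d = "Suc c"
    have c: "c \<in> {1..<n}" "?d \<in> {1..<n}" "inv w (Suc c) < inv w c" "inv w (Suc ?d) < inv w ?d"
      using cd A B by auto
    note wc = sw[OF w c(1)] and wd = sw[OF w c(2)]
    note wdc = sw[OF wc c(2)] and wcd = sw[OF wd c(1)]
    have eq: "sref c \<circ> (sref ?d \<circ> (sref c \<circ> w)) = sref ?d \<circ> (sref c \<circ> (sref ?d \<circ> w))"
      by (auto simp: fun_eq_iff sref_apply)
    \<comment> \<open>Both \<open>c\<close> and \<open>Suc c\<close> are left descents, so the
      values \<open>c + 2\<close>, \<open>c + 1\<close>, \<open>c\<close> occur in this order in
      \<open>w\<close>. Hence all three letters of the braid word can be stripped from
      \<open>w\<close>, in either spelling, and \<open>zs\<close> spells the common rest.\<close>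
    obtain zs where zs: "reduced_word n (sref c \<circ> (sref ?d \<circ> (sref c \<circ> w))) zs"
      using reduced_word_exists[OF sw[OF wdc c(1)]] by blast
    have "reduced_word n (sref ?d \<circ> (sref c \<circ> w)) (c # zs)"
      by (rule reduced_word_Cons[OF zs wdc c(1)])
        (use c in \<open>simp add: inv_sref_comp[OF w c(1)] inv_sref_comp[OF wc c(2)] sref_apply\<close>)
    then have 1: "reduced_word n (sref c \<circ> w) (?d # c # zs)"
      by (rule reduced_word_Cons[OF _ wc c(2)])
        (use c in \<open>simp add: inv_sref_comp[OF w c(1)] sref_apply\<close>)
    have "reduced_word n (sref c \<circ> (sref ?d \<circ> w)) (?d # zs)"
      by (rule reduced_word_Cons[OF zs[unfolded eq] wcd c(2)])
        (use c in \<open>simp add: inv_sref_comp[OF w c(2)] inv_sref_comp[OF wd c(1)] sref_apply\<close>)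
    then have 2: "reduced_word n (sref ?d \<circ> w) (c # ?d # zs)"
      by (rule reduced_word_Cons[OF _ wd c(1)])
        (use c in \<open>simp add: inv_sref_comp[OF w c(2)] sref_apply\<close>)
    have "f c * (f ?d * (f c * prod_list (map f zs))) = f ?d * (f c * (f ?d * prod_list (map f zs)))"
      using braid[of c] c by (simp add: mult.assoc[symmetric])
    then show ?thesis
      using cd IHu[of "?d # c # zs"] IHv[of "?d # c # zs"] IHu[of "c # ?d # zs"] IHv[of "c # ?d # zs"]
        1 2 us vs
      by auto
  qed
  consider "a = b" | "a + 1 < b" | "b + 1 < a" | "b = Suc a" | "a = Suc b" by linarith
  then show ?case
  proof cases
    case 1
    then show ?thesis using IHu[of vs'] B(1) us vs by simp
  next
    case 2
    then show ?thesis using far by blast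
  next
    case 3
    then show ?thesis using far by blast
  next
    case 4
    then show ?thesis using near by blast
  next
    case 5
    then show ?thesis using near by blast
  qed
qed

section \<open>The symmetrizer\<close>

lemma central_commute: "central c \<Longrightarrow> y * c = c * y"
  by (simp add: central_def)

lemma central_left_commute: "central c \<Longrightarrow> y * (c * z) = c * (y * z)"
  by (metis central_def mult.assoc)

lemma central_0: "central 0"
  and central_1: "central 1"
  and central_add: "central a \<Longrightarrow> central b \<Longrightarrow> central (a + b)"
  and central_diff: "central a \<Longrightarrow> central b \<Longrightarrow> central (a - b)"
  by (auto simp: central_def algebra_simps)

lemma central_mult: "central a \<Longrightarrow> central b \<Longrightarrow> central (a * b)"
  unfolding central_def by (metis mult.assoc)

lemma central_power: "central a \<Longrightarrow> central (a ^ m)"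
  by (induction m) (auto intro: central_1 central_mult)

lemma central_sum: "(\<And>i. i \<in> A \<Longrightarrow> central (g i)) \<Longrightarrow> central (sum g A)"
  by (induction A rule: infinite_finite_induct) (auto intro: central_0 central_add)

lemma central_prod_list: "(\<And>y. y \<in> set ys \<Longrightarrow> central y) \<Longrightarrow> central (prod_list ys)"
  by (induction ys) (auto intro: central_1 central_mult)

lemma central_inverse:
  assumes "central c" "d * c = 1" "c * d = 1"
  shows "central d"
  unfolding central_def
proof
  fix y
  have "d * y = d * y * (c * d)" using assms by simp
  also have "\<dots> = d * (y * c) * d" by (simp add: mult.assoc)
  also have "\<dots> = (d * c) * y * d" by (simp only: central_commute[OF assms(1), of y] mult.assoc)
  finally show "d * y = y * d" using assms by simp
qed

text \<open>The factors are multiplied in list order, as in \<open>prod_list\<close> over a sorted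
  subset. The recursion is that of \<open>expand\<close> without the jump terms.\<close>

primrec elem_sym :: "(nat \<Rightarrow> 'a::ring_1) \<Rightarrow> nat \<Rightarrow> nat list \<Rightarrow> 'a" where
  "elem_sym x r [] = (if r = 0 then 1 else 0)"
| "elem_sym x r (s # L) =
     elem_sym x r L + (case r of 0 \<Rightarrow> 0 | Suc r' \<Rightarrow> x s * elem_sym x r' L)"

lemma elem_sym_snoc:
  "elem_sym x r (L @ [s]) = elem_sym x r L + (case r of 0 \<Rightarrow> 0 | Suc r' \<Rightarrow> elem_sym x r' L * x s)"
  by (induction L arbitrary: r) (auto split: nat.splits simp: algebra_simps)

text \<open>Serves for \<open>c = Tb i\<close>, which commutes with neither \<open>x i\<close> nor
  \<open>x (Suc i)\<close>: these two variables are kept inside the block \<open>M\<close> and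
  treated together.\<close>

lemma elem_sym_append_commute:
  assumes "\<And>s. s \<in> set L \<Longrightarrow> c * x s = x s * c"
    and "\<And>r. c * elem_sym x r M = elem_sym x r M * c"
  shows "c * elem_sym x r (L @ M) = elem_sym x r (L @ M) * c"
  using assms(1)
proof (induction L arbitrary: r)
  case Nil
  then show ?case using assms(2) by simp
next
  case (Cons s L)
  have "c * (x s * elem_sym x r' (L @ M)) = x s * elem_sym x r' (L @ M) * c" for r'
  proof -
    have "c * (x s * elem_sym x r' (L @ M)) = x s * (c * elem_sym x r' (L @ M))"
      using Cons.prems[of s] by (simp add: mult.assoc[symmetric])
    then show ?thesis using Cons by (simp add: mult.assoc)
  qed
  then show ?case using Cons by (simp add: distrib_left distrib_right split: nat.split)
qed

lemma elem_sym_commute: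
  assumes "\<And>s. s \<in> set L \<Longrightarrow> c * x s = x s * c"
  shows "c * elem_sym x r L = elem_sym x r L * c"
  using elem_sym_append_commute[of L c x "[]"] assms by simp

section \<open>The defining relations rewritten for \<open>Tb\<close>\<close>

locale hecke =
  fixes n k :: nat and p q h cinv :: "'a::ring_1" and T x :: "nat \<Rightarrow> 'a"
  assumes rels: "hecke_rels n p q h T x"
    and cinv_left: "cinv * (qfact p q k * qfact p q (n - k)) = 1"
    and cinv_right: "(qfact p q k * qfact p q (n - k)) * cinv = 1"
    and k_le_n: "k \<le> n"
begin

text \<open>Up to the scalar \<open>p * q\<close> this is the inverse of \<open>T i\<close>, since
  the quadratic relation reads \<open>T i * (T i + p - q) = p * q\<close>. The roots for
  \<open>Tb i\<close> are \<open>p\<close> and \<open>-q\<close>.\<close>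

definition Tb :: "nat \<Rightarrow> 'a" where "Tb i = T i + p - q"

definition xfac :: "nat \<Rightarrow> 'a" where "xfac s = h - (p - q) * x s"

lemma central_p: "central p" and central_q: "central q" and central_h: "central h"
  using rels by (auto simp: hecke_rels_def)

lemmas p_comm = central_commute[OF central_p]
lemmas q_comm = central_commute[OF central_q]
lemmas h_comm = central_commute[OF central_h]

lemma central_pq: "central (p - q)"
  by (intro central_diff central_p central_q)

lemma T_sq: "i \<in> {1..<n} \<Longrightarrow> T i * T i = q * T i - p * T i + p * q"
proof -
  assume "i \<in> {1..<n}"
  then have "(T i + p) * (T i - q) = 0" using rels by (auto simp: hecke_rels_def)
  then have "T i * T i - T i * q + p * T i - p * q = 0" by (simp add: algebra_simps)
  then show ?thesis by (simp add: q_comm[of "T i"] algebra_simps)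
qed

lemma Tb_sq: "i \<in> {1..<n} \<Longrightarrow> Tb i * Tb i = (p - q) * Tb i + p * q"
  by (simp add: Tb_def T_sq algebra_simps p_comm[of "T i"] q_comm[of "T i"] q_comm[of p])

lemma Tb_comm: "i \<in> {1..<n} \<Longrightarrow> j \<in> {1..<n} \<Longrightarrow> i + 1 < j \<Longrightarrow> Tb i * Tb j = Tb j * Tb i"
proof -
  assume "i \<in> {1..<n}" "j \<in> {1..<n}" "i + 1 < j"
  moreover from this have "i \<in> {1..<n}" by simp
  ultimately have "T i * T j = T j * T i" using rels unfolding hecke_rels_def by blast
  then show ?thesis
    by (simp add: Tb_def algebra_simps p_comm[of "T i"] q_comm[of "T i"] p_comm[of "T j"] q_comm[of "T j"])
qed

text \<open>In \<open>(A + c) * (B + c) * (A + c)\<close> the part not symmetric in \<open>A\<close>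
  and \<open>B\<close>, apart from \<open>A * (B * A)\<close>, is \<open>c * (A * A)\<close> plus
  twice \<open>c * (c * A)\<close> plus \<open>c * (c * B)\<close>. The quadratic relation replaces
  \<open>A * A\<close> by \<open>- (c * A) + p * q\<close>, which leaves a symmetric
  expression.\<close>

lemma Tb_braid:
  assumes "1 \<le> i" "i + 1 < n"
  shows "Tb i * Tb (i+1) * Tb i = Tb (i+1) * Tb i * Tb (i+1)"
proof -
  define c where "c = p - q"
  have cc: "central c" unfolding c_def by (rule central_pq)
  have br: "T i * (T (i+1) * T i) = T (i+1) * (T i * T (i+1))"
    using assms rels by (simp add: hecke_rels_def mult.assoc)
  have sq: "T j * T j = - (c * T j) + p * q" if "j \<in> {i, i+1}" for j
    using T_sq[of j] that assms by (auto simp: c_def algebra_simps)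
  have exp: "(A + c) * (B + c) * (A + c) =
      A * (B * A) + c * (A * B) + c * (B * A) + c * (A * A) + c * (c * A) + c * (c * A) + c * (c * B)
        + c * (c * c)" for A B
    by (simp add: distrib_left distrib_right mult.assoc central_commute[OF cc, of A]
        central_commute[OF cc, of B] central_left_commute[OF cc, of A] central_left_commute[OF cc, of B] add_ac)
  have "Tb j = T j + c" for j by (simp add: Tb_def c_def)
  then show ?thesis
    unfolding exp \<open>\<And>j. Tb j = T j + c\<close>
    by (simp add: br[simplified] sq[simplified] distrib_left right_diff_distrib add_ac)
qed

lemma Tb_x_far: "i \<in> {1..<n} \<Longrightarrow> j \<in> {1..n} \<Longrightarrow> j \<noteq> i \<Longrightarrow> j \<noteq> Suc i \<Longrightarrow> Tb i * x j = x j * Tb i"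
  using rels by (simp add: hecke_rels_def Tb_def algebra_simps p_comm[of "x j"] q_comm[of "x j"])

text \<open>The summand \<open>(p - q) * x i\<close> of \<open>Tb i * x i\<close> cancels the one in
  the relation for \<open>T i\<close>. Rewriting \<open>T i\<close> as \<open>Tb i - (p - q)\<close>
  on the right then brings in \<open>x (Suc i)\<close>, so the correction carries the index
  \<open>Suc i\<close>.\<close>

lemma Tb_x_left: "i \<in> {1..<n} \<Longrightarrow> Tb i * x i = x (Suc i) * Tb i + xfac (Suc i)"
  using rels
  by (simp add: hecke_rels_def Tb_def xfac_def algebra_simps p_comm[of "x _"] q_comm[of "x _"])

lemma Tb_x_right: "i \<in> {1..<n} \<Longrightarrow> Tb i * x (Suc i) = x i * Tb i - xfac (Suc i)"
  using rels
  by (simp add: hecke_rels_def Tb_def xfac_def algebra_simps p_comm[of "x _"] q_comm[of "x _"])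

lemma Tb_xfac_far:
  assumes "i \<in> {1..<n}" "j \<in> {1..n}" "j \<noteq> i" "j \<noteq> Suc i"
  shows "Tb i * xfac j = xfac j * Tb i"
  unfolding xfac_def right_diff_distrib left_diff_distrib[of _ _ "Tb i"]
  by (simp only: Tb_x_far[OF assms] central_left_commute[OF central_pq] h_comm[of "Tb i"] mult.assoc)

text \<open>The last factor is \<open>T i\<close> in disguise. It acts by \<open>q\<close> wherever
  \<open>Tb i\<close> acts by \<open>p\<close>, which produces the factor \<open>q\<close> in
  \<open>Tb_expand_at\<close>.\<close>

lemma Tb_xfac_left:
  assumes "i \<in> {1..<n}"
  shows "Tb i * xfac i = xfac (Suc i) * (Tb i - (p - q))"
proof -
  have "Tb i * xfac i = h * Tb i - (p - q) * (Tb i * x i)"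
    unfolding xfac_def right_diff_distrib
    by (simp only: central_left_commute[OF central_pq] h_comm[of "Tb i"])
  also have "\<dots> = h * Tb i - (p - q) * (x (Suc i) * Tb i) - (p - q) * xfac (Suc i)"
    unfolding Tb_x_left[OF assms] by (simp only: distrib_left diff_diff_eq)
  also have "\<dots> = xfac (Suc i) * Tb i - xfac (Suc i) * (p - q)"
    unfolding central_commute[OF central_pq, of "xfac _"]
    by (simp add: xfac_def left_diff_distrib mult.assoc)
  finally show ?thesis by (simp only: right_diff_distrib)
qed

text \<open>By uniqueness of the product over reduced words, the word chosen by \<open>SOME\<close>
  may be replaced by any convenient one.\<close>

lemma Tbar_eq:
  assumes "reduced_word n w ws"
  shows "Tbar n p q T w = prod_list (map Tb ws)"
  unfolding Tbar_def Tb_def[symmetric]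
proof (rule prod_list_reduced_word_unique)
  show "reduced_word n w (SOME ws. reduced_word n w ws)" using assms by (rule someI)
qed (use assms Tb_braid Tb_comm in auto)

lemma Tbar_id: "Tbar n p q T id = 1"
proof -
  have "reduced_word n id []"
    by (simp only: reduced_word_def perm_of_word_simps inv_count_id) simp
  from Tbar_eq[OF this] show ?thesis by simp
qed

lemma Tbar_sref_up:
  assumes w: "w permutes {1..n}" and a: "a \<in> {1..<n}" and asc: "inv w a < inv w (Suc a)"
  shows "Tbar n p q T (sref a \<circ> w) = Tb a * Tbar n p q T w"
proof -
  obtain ws where ws: "reduced_word n w ws" using reduced_word_exists[OF w] ..
  have "reduced_word n (sref a \<circ> w) (a # ws)"
    by (rule reduced_word_Cons[OF _ sref_comp_permutes[OF w a] a])
      (use ws asc in \<open>simp_all add: inv_sref_comp[OF w a] sref_apply\<close>)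
  from Tbar_eq[OF this] Tbar_eq[OF ws] show ?thesis by simp
qed

text \<open>The same longer permutation is reached by a letter on the right, so the extended word is
  again reduced. Together with \<open>Tbar_sref_up\<close> this moves \<open>Tb a\<close> through
  \<open>Tbar_w\<close> as \<open>Tb j\<close>.\<close>

lemma Tbar_snoc:
  assumes w: "w permutes {1..n}" and a: "a \<in> {1..<n}" and asc: "inv w a < inv w (Suc a)"
    and j: "j \<in> {1..<n}" and eq: "sref a \<circ> w = w \<circ> sref j"
  shows "Tbar n p q T (sref a \<circ> w) = Tbar n p q T w * Tb j"
proof -
  obtain ws where ws: "reduced_word n w ws" using reduced_word_exists[OF w] ..
  have "perm_of_word (ws @ [j]) = sref a \<circ> w"
    unfolding eq perm_of_word_append perm_of_word_simps using ws by (simp add: reduced_word_def)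
  then have "reduced_word n (sref a \<circ> w) (ws @ [j])"
    using ws j inv_count_sref_up[OF w a asc] by (simp add: reduced_word_def)
  from Tbar_eq[OF this] Tbar_eq[OF ws] show ?thesis by simp
qed

lemma sref_young:
  assumes "v \<in> young_sub n k" "i \<in> {1..<n}" "i \<noteq> k"
  shows "sref i \<circ> v \<in> young_sub n k"
proof -
  have "sref i ` {1..k} = {1..k}"
  proof (rule card_subset_eq)
    show "sref i ` {1..k} \<subseteq> {1..k}" using assms by (auto simp: sref_apply)
    show "card (sref i ` {1..k}) = card {1..k}"
      by (rule card_image, rule inj_on_inverseI[of _ "sref i"]) simp
  qed simp
  then show ?thesis
    using assms sref_comp_permutes[of v n i] unfolding young_sub_def mem_Collect_eq
    by (metis image_comp)
qed

lemma young_inv: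
  assumes "v \<in> young_sub n k" "j \<in> {1..n}"
  shows "inv v j \<le> k \<longleftrightarrow> j \<le> k"
proof -
  have v: "v permutes {1..n}" "v ` {1..k} = {1..k}" using assms by (auto simp: young_sub_def)
  have i: "inv v j \<in> {1..n}" by (rule inv_in_interval[OF v(1) assms(2)])
  have "inv v j \<in> {1..k} \<longleftrightarrow> v (inv v j) \<in> v ` {1..k}"
    using permutes_inj[OF v(1)] by (simp add: inj_image_mem_iff)
  then show ?thesis using i assms(2) permutes_inverses(1)[OF v(1)] v(2) by auto
qed

text \<open>The value \<open>k\<close> sits at a position at most \<open>k\<close> and
  \<open>Suc k\<close> at a later one, so \<open>k\<close> is never a left descent; stripping any
  other letter stays in the Young subgroup.\<close>

lemma young_reduced_word:
  assumes "v \<in> young_sub n k" "reduced_word n v ws"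
  shows "k \<notin> set ws"
  using assms
proof (induction ws arbitrary: v)
  case (Cons a ws)
  note D = reduced_word_ConsD[OF Cons.prems(2)]
  have "a \<noteq> k"
  proof
    assume "a = k"
    then have "inv v k \<le> k" "\<not> inv v (Suc k) \<le> k"
      using young_inv[OF Cons.prems(1)] D(3) by auto
    then show False using D(4) \<open>a = k\<close> by simp
  qed
  then show ?case using Cons.IH[OF sref_young[OF Cons.prems(1) D(3)] D(1)] by simp
qed simp

text \<open>No inversion straddles the two blocks, and \<open>dd n k\<close> counts all pairs within
  a block. Hence the exponent of \<open>q\<close> in the symmetrizer is never a truncated
  subtraction.\<close>

lemma young_inv_count_le:
  assumes "v \<in> young_sub n k"
  shows "inv_count n v \<le> dd n k"
proof -
  have v: "v permutes {1..n}" "v ` {1..k} = {1..k}" using assms by (auto simp: young_sub_def)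
  let ?A = "{B. B \<subseteq> {1..k} \<and> card B = 2}" and ?B = "{B. B \<subseteq> {Suc k..n} \<and> card B = 2}"
  let ?I = "{(i, j). 1 \<le> i \<and> i < j \<and> j \<le> n \<and> v j < v i}"
  have vk: "v i \<le> k \<longleftrightarrow> i \<le> k" if "i \<in> {1..n}" for i
  proof -
    have "v i \<in> {1..n}" using permutes_in_image[OF v(1)] that by simp
    from young_inv[OF assms this] show ?thesis using permutes_inverses(2)[OF v(1)] by simp
  qed
  have "(\<lambda>(i, j). {i, j}) ` ?I \<subseteq> ?A \<union> ?B"
  proof clarify
    fix i j assume ij: "1 \<le> i" "i < j" "j \<le> n" "v j < v i"
      and "\<not> ({i, j} \<subseteq> {Suc k..n} \<and> card {i, j} = 2)"
    then have "i \<le> k" by auto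
    then have "v j \<le> k" using vk[of i] ij by auto
    then show "{i, j} \<subseteq> {1..k} \<and> card {i, j} = 2" using vk[of j] ij by auto
  qed
  then have "card ((\<lambda>(i, j). {i, j}) ` ?I) \<le> card (?A \<union> ?B)"
    by (intro card_mono) auto
  also have "\<dots> \<le> card ?A + card ?B" by (rule card_Un_le)
  also have "\<dots> = dd n k" by (simp add: n_subsets dd_def)
  also have "card ((\<lambda>(i, j). {i, j}) ` ?I) = card ?I"
    by (rule card_image) (auto simp: inj_on_def doubleton_eq_iff)
  finally show ?thesis by (simp add: inv_count_def)
qed

section \<open>The symmetrizer absorbs \<open>Tb i\<close> for \<open>i \<noteq> k\<close> and
  commutes with the elementary symmetric polynomials\<close>

abbreviation Sig :: 'a where "Sig \<equiv> Sigma_nk n k p q T cinv"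

lemma central_cinv: "central cinv"
proof -
  have "central (qint p q m)" for m
    unfolding qint_def by (intro central_sum central_mult central_power central_p central_q)
  then have "central (qfact p q m)" for m
    unfolding qfact_def by (intro central_prod_list) auto
  then show ?thesis using central_inverse[OF central_mult cinv_left cinv_right] by blast
qed

lemma finite_young: "finite (young_sub n k)"
  using finite_permutations[of "{1..n}"] by (simp add: young_sub_def)

text \<open>Pairing v with s_i v, the sum becomes a left multiple of q + Tb i,
  and Tb i (q + Tb i) = p (q + Tb i).\<close>
lemma Tb_Sig:
  assumes i: "i \<in> {1..<n}" "i \<noteq> k"
  shows "Tb i * Sig = p * Sig"
proof -
  let ?Y = "young_sub n k"
  \<comment> \<open>From each pair consisting of \<open>v\<close> and \<open>s_i v\<close>, the
    shorter permutation.\<close>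
  let ?U = "{v \<in> ?Y. inv v i < inv v (Suc i)}"
  let ?t = "\<lambda>v. q ^ (dd n k - inv_count n v) * Tbar n p q T v"
  let ?c = "\<lambda>v. q ^ (dd n k - Suc (inv_count n v))"
  have Yperm: "v permutes {1..n}" if "v \<in> ?Y" for v using that by (simp add: young_sub_def)
  have inv_s: "inv (sref i \<circ> v) i = inv v (Suc i)" "inv (sref i \<circ> v) (Suc i) = inv v i"
    if "v \<in> ?Y" for v
    using inv_sref_comp[OF Yperm[OF that] i(1)] by (auto simp: sref_apply)
  have D: "?Y - ?U = (\<lambda>v. sref i \<circ> v) ` ?U"
  proof (intro equalityI subsetI)
    fix v assume v: "v \<in> ?Y - ?U"
    then have "inv v (Suc i) < inv v i" using inv_neq_Suc[OF Yperm, of v i] by force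
    then have "sref i \<circ> v \<in> ?U" using v sref_young[of v i] i inv_s[of v] by simp
    then have "sref i \<circ> (sref i \<circ> v) \<in> (\<lambda>v. sref i \<circ> v) ` ?U" by (rule imageI)
    then show "v \<in> (\<lambda>v. sref i \<circ> v) ` ?U" unfolding sref_comp_sref .
  next
    fix v assume "v \<in> (\<lambda>v. sref i \<circ> v) ` ?U"
    then obtain u where u: "u \<in> ?U" "v = sref i \<circ> u" by blast
    then show "v \<in> ?Y - ?U" using sref_young[of u i] i inv_s[of u] by simp
  qed
  have inj: "inj_on (\<lambda>v. sref i \<circ> v) ?U" by (rule inj_on_inverseI[of _ "\<lambda>v. sref i \<circ> v"]) simp
  have pair: "?t v + ?t (sref i \<circ> v) = ?c v * ((q + Tb i) * Tbar n p q T v)" if v: "v \<in> ?U" for v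
  proof -
    have vY: "v \<in> ?Y" and asc: "inv v i < inv v (Suc i)" using v by auto
    note up = inv_count_sref_up[OF Yperm[OF vY] i(1) asc]
    \<comment> \<open>The longer partner also satisfies the length bound, so the exponent at
      \<open>v\<close> is at least one. The extra power of \<open>q\<close> there is the
      \<open>q\<close> in \<open>q + Tb i\<close>.\<close>
    have "Suc (inv_count n v) \<le> dd n k"
      using young_inv_count_le[OF sref_young[OF vY i]] unfolding up .
    then have e: "dd n k - inv_count n v = Suc (dd n k - Suc (inv_count n v))" by simp
    have "?t v = ?c v * (q * Tbar n p q T v)"
      unfolding e power_Suc2 by (simp only: mult.assoc)
    moreover have "?t (sref i \<circ> v) = ?c v * (Tb i * Tbar n p q T v)"
      unfolding up Tbar_sref_up[OF Yperm[OF vY] i(1) asc] ..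
    ultimately show ?thesis by (simp only: distrib_left distrib_right)
  qed
  have eq: "sum ?t ?Y = (\<Sum>v\<in>?U. ?c v * ((q + Tb i) * Tbar n p q T v))"
  proof -
    have "sum ?t ?Y = sum ?t ?U + sum ?t (?Y - ?U)"
      using finite_young by (subst sum.subset_diff[of ?U ?Y]) (auto simp: add.commute)
    also have "sum ?t (?Y - ?U) = (\<Sum>v\<in>?U. ?t (sref i \<circ> v))"
      unfolding D by (subst sum.reindex[OF inj]) (simp only: o_def)
    finally show ?thesis by (simp only: sum.distrib[symmetric] pair cong: sum.cong)
  qed
  have fac: "Tb i * (q + Tb i) = p * (q + Tb i)"
    using Tb_sq[OF i(1)] by (simp add: distrib_left left_diff_distrib q_comm[of "Tb i"] q_comm[of p])
  have "Tb i * sum ?t ?Y = p * sum ?t ?Y"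
    unfolding eq sum_distrib_left
  proof (rule sum.cong[OF refl])
    fix v
    have "Tb i * ((q + Tb i) * Tbar n p q T v) = p * ((q + Tb i) * Tbar n p q T v)"
      unfolding mult.assoc[symmetric] fac ..
    then show "Tb i * (?c v * ((q + Tb i) * Tbar n p q T v)) =
        p * (?c v * ((q + Tb i) * Tbar n p q T v))"
      by (simp only: central_left_commute[OF central_power[OF central_q]])
  qed
  then show ?thesis unfolding Sigma_nk_def
    by (simp only: central_left_commute[OF central_cinv])
qed

text \<open>For \<open>i > k\<close> neither \<open>x i\<close> nor \<open>x (Suc i)\<close> occurs.
  For \<open>i < k\<close> both occur, but only through their sum and product; these commute with
  \<open>Tb i\<close> because the correction terms of \<open>Tb_x_left\<close> and
  \<open>Tb_x_right\<close> cancel.\<close>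

lemma Tb_elem_sym:
  assumes i: "i \<in> {1..<n}" "i \<noteq> k"
  shows "Tb i * elem_sym x r [1..<Suc k] = elem_sym x r [1..<Suc k] * Tb i"
proof (cases "i < k")
  case False
  then show ?thesis using assms k_le_n by (intro elem_sym_commute Tb_x_far) auto
next
  case True
  let ?L = "[Suc (Suc i)..<Suc k]"
  have far: "Tb i * x s = x s * Tb i" if "s \<in> set ?L \<union> set [1..<i]" for s
    using that i k_le_n True by (intro Tb_x_far) auto
  have L: "Tb i * elem_sym x r ?L = elem_sym x r ?L * Tb i" for r
    by (rule elem_sym_commute) (use far in blast)
  have add: "Tb i * (x i + x (Suc i)) = (x i + x (Suc i)) * Tb i"
    by (simp only: distrib_left distrib_right Tb_x_left[OF i(1)] Tb_x_right[OF i(1)]) simp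
  have xx: "x i * x (Suc i) = x (Suc i) * x i" using rels i by (simp add: hecke_rels_def)
  have mul: "Tb i * (x i * x (Suc i)) = x i * x (Suc i) * Tb i"
  proof -
    have "Tb i * (x i * x (Suc i)) = x (Suc i) * (Tb i * x (Suc i)) + xfac (Suc i) * x (Suc i)"
      unfolding mult.assoc[symmetric] Tb_x_left[OF i(1)] by (simp only: distrib_right mult.assoc)
    also have "\<dots> = x (Suc i) * (x i * Tb i) - x (Suc i) * xfac (Suc i) + xfac (Suc i) * x (Suc i)"
      unfolding Tb_x_right[OF i(1)] by (simp only: right_diff_distrib)
    also have "x (Suc i) * xfac (Suc i) = xfac (Suc i) * x (Suc i)"
      by (simp add: xfac_def algebra_simps h_comm[of "x _"] p_comm[of "x _"] q_comm[of "x _"]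
          central_left_commute[OF central_p, of "x _"] central_left_commute[OF central_q, of "x _"])
    finally show ?thesis by (simp add: xx mult.assoc[symmetric])
  qed
  have M: "Tb i * elem_sym x r (i # Suc i # ?L) = elem_sym x r (i # Suc i # ?L) * Tb i" for r
  proof -
    \<comment> \<open>Sorts the monomials by how many of the two variables \<open>x i\<close>,
      \<open>x (Suc i)\<close> they contain.\<close>
    have one: "elem_sym x (Suc r') (i # Suc i # ?L) = elem_sym x (Suc r') ?L
        + (x i + x (Suc i)) * elem_sym x r' ?L
        + (case r' of 0 \<Rightarrow> 0 | Suc r'' \<Rightarrow> x i * x (Suc i) * elem_sym x r'' ?L)" for r'
      by (simp add: algebra_simps split: nat.split)
    have *: "Tb i * (c * e) = c * e * Tb i" if "Tb i * c = c * Tb i" "Tb i * e = e * Tb i" for c e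
      by (simp only: mult.assoc that(2)[symmetric]) (simp only: mult.assoc[symmetric] that(1))
    show ?thesis
    proof (cases r)
      case 0
      then show ?thesis using L[of 0] by simp
    next
      case (Suc r')
      show ?thesis unfolding Suc one
        using *[OF add L] *[OF mul L] L by (simp only: distrib_left distrib_right split: nat.split) simp
    qed
  qed
  have "[1..<Suc k] = [1..<i] @ i # Suc i # ?L"
  proof -
    have "[1..<Suc k] = [1..<i] @ [i..<Suc k]"
      using i True upt_add_eq_append[of 1 i "Suc k - i"] by (simp del: upt_Suc)
    also have "[i..<Suc k] = i # Suc i # ?L" using True by (simp add: upt_conv_Cons del: upt_Suc)
    finally show ?thesis .
  qed
  then show ?thesis
    using elem_sym_append_commute[of "[1..<i]" "Tb i" x, OF far M] by simp
qed

text \<open>Reduced words of elements of the Young subgroup avoid the letter \<open>k\<close>, so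
  \<open>Tb_elem_sym\<close> applies to each letter in turn.\<close>

lemma Sig_elem_sym: "Sig * elem_sym x r [1..<Suc k] = elem_sym x r [1..<Suc k] * Sig"
proof -
  define e where "e = elem_sym x r [1..<Suc k]"
  have word: "prod_list (map Tb ws) * e = e * prod_list (map Tb ws)"
    if "set ws \<subseteq> {1..<n}" "k \<notin> set ws" for ws
    using that
  proof (induction ws)
    case (Cons a ws)
    then have "a \<in> {1..<n}" "a \<noteq> k" by auto
    note c = Tb_elem_sym[OF this, of r, folded e_def]
    have "prod_list (map Tb (a # ws)) * e = Tb a * (prod_list (map Tb ws) * e)"
      by (simp add: mult.assoc)
    also have "\<dots> = (Tb a * e) * prod_list (map Tb ws)" using Cons by (simp add: mult.assoc)
    finally show ?case by (simp add: c mult.assoc)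
  qed simp
  have "Tbar n p q T v * e = e * Tbar n p q T v" if v: "v \<in> young_sub n k" for v
  proof -
    obtain ws where ws: "reduced_word n v ws"
      using v reduced_word_exists[of v n] by (auto simp: young_sub_def)
    show ?thesis unfolding Tbar_eq[OF ws]
      by (rule word) (use ws young_reduced_word[OF v ws] in \<open>auto simp: reduced_word_def\<close>)
  qed
  then show ?thesis
    unfolding Sigma_nk_def e_def[symmetric]
    by (simp add: mult.assoc sum_distrib_left sum_distrib_right central_left_commute[OF central_cinv, of e]
        central_left_commute[OF central_power[OF central_q], of e])
qed

end

section \<open>Grassmannian permutations\<close>

text \<open>These are the minimal-length representatives of the left cosets of the Young subgroup,
  indexed by the set \<open>S\<close> of their first \<open>k\<close> values.\<close>

definition grass :: "nat \<Rightarrow> nat \<Rightarrow> (nat \<Rightarrow> nat) \<Rightarrow> nat set \<Rightarrow> bool" where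
  "grass n k w S \<longleftrightarrow> w permutes {1..n} \<and> w ` {1..k} = S \<and>
     (\<forall>i j. 1 \<le> i \<and> i < j \<and> j \<le> k \<longrightarrow> w i < w j) \<and>
     (\<forall>i j. k < i \<and> i < j \<and> j \<le> n \<longrightarrow> w i < w j)"

definition grass_perm :: "nat \<Rightarrow> nat \<Rightarrow> nat set \<Rightarrow> nat \<Rightarrow> nat" where
  "grass_perm n k S j =
     (if 1 \<le> j \<and> j \<le> k then sorted_list_of_set S ! (j - 1)
      else if k < j \<and> j \<le> n then sorted_list_of_set ({1..n} - S) ! (j - k - 1)
      else j)"

lemma sorted_wrt_map_upt:
  assumes "\<And>i j. l \<le> i \<Longrightarrow> i < j \<Longrightarrow> j < m \<Longrightarrow> w i < (w j :: nat)"
  shows "sorted_wrt (<) (map w [l..<m])"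
  using assms by (auto simp: sorted_wrt_iff_nth_less)

text \<open>A set has only one increasing enumeration. The offset \<open>l\<close> is
  \<open>0\<close> for the first block of positions and \<open>k\<close> for the second.\<close>

lemma nth_eq_increasing:
  assumes "\<And>i j. l < i \<Longrightarrow> i < j \<Longrightarrow> j \<le> m \<Longrightarrow> w i < (w j :: nat)" and "w ` {Suc l..m} = A"
    and "l < j" "j \<le> m"
  shows "w j = sorted_list_of_set A ! (j - l - 1)"
proof -
  have "map w [Suc l..<Suc m] = sorted_list_of_set A"
  proof (rule sym, rule strict_sorted_equal)
    show "sorted_wrt (<) (map w [Suc l..<Suc m])" by (rule sorted_wrt_map_upt) (use assms in auto)
    show "sorted_wrt (<) (sorted_list_of_set A)" by simp
    show "set (sorted_list_of_set A) = set (map w [Suc l..<Suc m])"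
      using assms(2) by (auto simp: atLeastLessThanSuc_atLeastAtMost simp del: upt_Suc)
  qed
  then have "sorted_list_of_set A ! (j - l - 1) = map w [Suc l..<Suc m] ! (j - l - 1)" by simp
  also have "\<dots> = w j" using assms(3,4) by (subst nth_map) (auto simp del: upt_Suc)
  finally show ?thesis ..
qed

lemma grass_complement:
  assumes "grass n k w S" "k \<le> n"
  shows "w ` {Suc k..n} = {1..n} - S"
proof -
  have "{Suc k..n} = {1..n} - {1..k}" using assms(2) by auto
  then show ?thesis
    using assms permutes_image[of w "{1..n}"] permutes_inj[of w "{1..n}"]
    by (simp add: grass_def image_set_diff)
qed

lemma grass_eq_grass_perm:
  assumes "grass n k w S" "k \<le> n"
  shows "w = grass_perm n k S"
proof
  fix j
  have w: "w permutes {1..n}" "w ` {1..k} = S" using assms by (auto simp: grass_def)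
  consider "1 \<le> j \<and> j \<le> k" | "k < j \<and> j \<le> n" | "j \<notin> {1..n}" by force
  then show "w j = grass_perm n k S j"
  proof cases
    case 1
    then show ?thesis using nth_eq_increasing[of 0 k w S j] assms w by (auto simp: grass_def grass_perm_def)
  next
    case 2
    then show ?thesis
      using nth_eq_increasing[of k n w "{1..n} - S" j] assms grass_complement[OF assms]
      by (auto simp: grass_def grass_perm_def)
  next
    case 3
    then show ?thesis using permutes_not_in[OF w(1)] assms(2) by (auto simp: grass_perm_def)
  qed
qed

lemma grass_grass_perm:
  assumes "S \<subseteq> {1..n}" "card S = k" "k \<le> n"
  shows "grass n k (grass_perm n k S) S"
proof -
  let ?w = "grass_perm n k S"
  have fin: "finite S" using assms(1) by (rule finite_subset) simp
  have len: "length (sorted_list_of_set S) = k"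
      "length (sorted_list_of_set ({1..n} - S)) = n - k"
    using assms fin by (auto simp: card_Diff_subset)
  have im: "?w ` {1..k} = S"
  proof -
    have "?w ` {1..k} = (\<lambda>j. sorted_list_of_set S ! j) ` ((\<lambda>j. j - 1) ` {1..k})"
      unfolding image_image by (rule image_cong) (auto simp: grass_perm_def)
    also have "(\<lambda>j. j - 1) ` {1..k} = {0..<k}"
      by (auto simp: image_iff intro!: bexI[of _ "Suc _"])
    finally show ?thesis using fin len(1) nth_image[of k "sorted_list_of_set S"] by simp
  qed
  have im': "?w ` {Suc k..n} = {1..n} - S"
  proof -
    have "?w ` {Suc k..n} = (\<lambda>j. sorted_list_of_set ({1..n} - S) ! j) ` ((\<lambda>j. j - k - 1) ` {Suc k..n})"
      unfolding image_image by (rule image_cong) (auto simp: grass_perm_def)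
    also have "(\<lambda>j. j - k - 1) ` {Suc k..n} = {0..<n - k}"
      by (auto simp: image_iff intro!: bexI[of _ "Suc (k + _)"])
    finally show ?thesis using len(2) nth_image[of "n - k" "sorted_list_of_set ({1..n} - S)"] by simp
  qed
  have "{1..n} = {1..k} \<union> {Suc k..n}" using assms(3) by auto
  then have tot: "?w ` {1..n} = {1..n}" using im im' assms(1) by (auto simp: image_Un)
  have "bij_betw ?w {1..n} {1..n}"
    using tot by (auto simp: bij_betw_def intro!: eq_card_imp_inj_on)
  then have "?w permutes {1..n}"
    by (rule bij_imp_permutes) (use assms(3) in \<open>auto simp: grass_perm_def\<close>)
  moreover have "?w i < ?w j" if "1 \<le> i" "i < j" "j \<le> k" for i j
    using that sorted_wrt_nth_less[of "(<)" "sorted_list_of_set S" "i - 1" "j - 1"] len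
    by (auto simp: grass_perm_def)
  moreover have "?w i < ?w j" if "k < i" "i < j" "j \<le> n" for i j
    using that sorted_wrt_nth_less[of "(<)" "sorted_list_of_set ({1..n} - S)" "i - k - 1" "j - k - 1"] len
    by (auto simp: grass_perm_def)
  ultimately show ?thesis using im by (auto simp: grass_def)
qed

lemma grass_inv_le:
  assumes "grass n k w S" "j \<in> {1..n}"
  shows "inv w j \<le> k \<longleftrightarrow> j \<in> S"
proof -
  have w: "w permutes {1..n}" "w ` {1..k} = S" using assms by (auto simp: grass_def)
  have "inv w j \<in> {1..n}" by (rule inv_in_interval[OF w(1) assms(2)])
  moreover have "inv w j \<in> {1..k} \<longleftrightarrow> w (inv w j) \<in> w ` {1..k}"
    using permutes_inj[OF w(1)] by (simp add: inj_image_mem_iff)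
  ultimately show ?thesis using permutes_inverses(1)[OF w(1)] w(2) by auto
qed

text \<open>Only the relative order of the values \<open>a\<close> and \<open>Suc a\<close> changes,
  and they lie in different blocks, so both blocks stay increasing.\<close>

lemma grass_sref:
  assumes g: "grass n k w S" and kn: "k \<le> n" and a: "a \<in> {1..<n}"
    and S: "(a \<in> S) \<noteq> (Suc a \<in> S)"
  shows "grass n k (sref a \<circ> w) (sref a ` S)"
proof -
  have w: "w permutes {1..n}" "w ` {1..k} = S" using g by (auto simp: grass_def)
  have less: "sref a u < sref a v" if "u < v" "\<not> (u = a \<and> v = Suc a)" for u v
    using that by (auto simp: sref_apply)
  have 1: "sref a (w i) < sref a (w j)" if "1 \<le> i" "i < j" "j \<le> k" for i j
  proof (rule less)
    show "w i < w j" using g that by (auto simp: grass_def)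
    have "w i \<in> S" "w j \<in> S" using w(2) that by auto
    then show "\<not> (w i = a \<and> w j = Suc a)" using S by auto
  qed
  have 2: "sref a (w i) < sref a (w j)" if "k < i" "i < j" "j \<le> n" for i j
  proof (rule less)
    show "w i < w j" using g that by (auto simp: grass_def)
    have "w i \<in> {1..n} - S" "w j \<in> {1..n} - S" using grass_complement[OF g kn] that by auto
    then show "\<not> (w i = a \<and> w j = Suc a)" using S by auto
  qed
  have "(sref a \<circ> w) ` {1..k} = sref a ` S" using w(2) by (metis image_comp)
  then show ?thesis
    using 1 2 sref_comp_permutes[OF w(1) a] unfolding grass_def by simp
qed

text \<open>Two consecutive values in one increasing block leave no room for a position between
  them. Hence \<open>s_a w = w s_j\<close> with \<open>j = inv w a\<close>, and
  \<open>j \<noteq> k\<close> because the positions \<open>j\<close> and \<open>j + 1\<close> share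
  a block.\<close>

lemma grass_adjacent:
  assumes g: "grass n k w S" and kn: "k \<le> n" and a: "a \<in> {1..<n}"
    and S: "(a \<in> S) = (Suc a \<in> S)"
  shows "inv w (Suc a) = Suc (inv w a)" "inv w a \<noteq> k" "inv w a \<in> {1..<n}"
proof -
  let ?u = "inv w a" and ?v = "inv w (Suc a)"
  have w: "w permutes {1..n}" using g by (auto simp: grass_def)
  have wu: "w ?u = a" "w ?v = Suc a" using permutes_inverses(1)[OF w] by auto
  have uv: "?u \<in> {1..n}" "?v \<in> {1..n}"
    using inv_in_interval[OF w, of a] inv_in_interval[OF w, of "Suc a"] a by auto
  have blk: "?u \<le> k \<longleftrightarrow> ?v \<le> k" using grass_inv_le[OF g] a S by auto
  have inc: "w i < w j" if "1 \<le> i" "i < j" "j \<le> n" "i \<le> k \<longleftrightarrow> j \<le> k" for i j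
    using g that unfolding grass_def by (cases "j \<le> k") auto
  have lt: "?u < ?v"
  proof (rule ccontr)
    assume "\<not> ?u < ?v"
    then have "?v < ?u" using inv_neq_Suc[OF w, of a] by linarith
    then have "w ?v < w ?u" using inc uv blk by auto
    then show False using wu by simp
  qed
  show eq: "?v = Suc ?u"
  proof (rule ccontr)
    assume "?v \<noteq> Suc ?u"
    then have "w ?u < w (Suc ?u)" "w (Suc ?u) < w ?v"
      using lt uv blk by (auto intro!: inc)
    then show False using wu by simp
  qed
  show "?u \<noteq> k" using eq blk by auto
  show "?u \<in> {1..<n}" using uv eq by auto
qed

section \<open>Left action of \<open>Tb a\<close> on the elements indexed by
  \<open>k\<close>-subsets\<close>

context hecke
begin

definition P :: "nat set \<Rightarrow> 'a" where
  "P S = Tbar n p q T (grass_perm n k S) * Sig"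

text \<open>The matrix of \<open>Tb a\<close> on the elements \<open>P S\<close>, applied to an
  arbitrary function \<open>g\<close> so that it can also be applied to the partial
  expansions.\<close>

definition tau :: "nat \<Rightarrow> (nat set \<Rightarrow> 'a) \<Rightarrow> nat set \<Rightarrow> 'a" where
  "tau a g S =
     (if a \<in> S \<and> Suc a \<notin> S then g (insert (Suc a) (S - {a}))
      else if a \<notin> S \<and> Suc a \<in> S then (p - q) * g S + p * q * g (insert a (S - {Suc a}))
      else p * g S)"

text \<open>The value \<open>a\<close> lies in the first block and \<open>Suc a\<close> in the
  second, so \<open>s_a w\<close> is longer than \<open>w\<close>; it is again Grassmannian, for the
  new set.\<close>

lemma P_raise:
  assumes a: "a \<in> {1..<n}" and S: "S \<subseteq> {1..n}" "card S = k" and "a \<in> S" "Suc a \<notin> S"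
  shows "Tb a * P S = P (insert (Suc a) (S - {a}))"
proof -
  note g = grass_grass_perm[OF S k_le_n]
  have w: "grass_perm n k S permutes {1..n}" using g by (simp add: grass_def)
  have asc: "inv (grass_perm n k S) a < inv (grass_perm n k S) (Suc a)"
    using grass_inv_le[OF g, of a] grass_inv_le[OF g, of "Suc a"] assms by auto
  have "sref a ` S = insert (Suc a) (S - {a})"
    using assms by (auto simp: sref_apply image_iff)
  then have "sref a \<circ> grass_perm n k S = grass_perm n k (insert (Suc a) (S - {a}))"
    using grass_eq_grass_perm[OF grass_sref[OF g k_le_n a] k_le_n] assms by simp
  then show ?thesis
    using Tbar_sref_up[OF w a asc] by (simp add: P_def mult.assoc)
qed

text \<open>If \<open>a\<close> can be raised, this is \<open>P_raise\<close>. If only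
  \<open>Suc a\<close> is in \<open>S\<close>, then \<open>P S\<close> is itself such a raised
  element and the quadratic relation applies. Otherwise \<open>Tb a\<close> passes through
  \<open>Tbar_w\<close> as some \<open>Tb j\<close> with \<open>j \<noteq> k\<close>, which the
  symmetrizer absorbs with factor \<open>p\<close>.\<close>

lemma Tb_P:
  assumes a: "a \<in> {1..<n}" and S: "S \<subseteq> {1..n}" "card S = k"
  shows "Tb a * P S = tau a P S"
proof -
  have fin: "finite S" using S(1) by (rule finite_subset) simp
  consider "a \<in> S" "Suc a \<notin> S" | "a \<notin> S" "Suc a \<in> S" | "(a \<in> S) = (Suc a \<in> S)" by blast
  then show ?thesis
  proof cases
    case 1
    then show ?thesis using P_raise[OF a S] by (simp add: tau_def)
  next
    case 2
    let ?S = "insert a (S - {Suc a})"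
    have S': "?S \<subseteq> {1..n}" "card ?S = k"
      using S a 2 fin card_Suc_Diff1[OF fin 2(2)] by auto
    have S_eq: "insert (Suc a) (?S - {a}) = S" using 2 by auto
    have PS: "P S = Tb a * P ?S" using P_raise[OF a S'] 2 unfolding S_eq by simp
    have "Tb a * P S = (Tb a * Tb a) * P ?S" by (simp add: PS mult.assoc)
    also have "\<dots> = (p - q) * P S + p * q * P ?S"
      unfolding Tb_sq[OF a] by (simp add: distrib_right PS mult.assoc)
    finally show ?thesis using 2 by (simp add: tau_def)
  next
    case 3
    note g = grass_grass_perm[OF S k_le_n]
    define w where "w = grass_perm n k S"
    have w: "w permutes {1..n}" using g by (simp add: grass_def w_def)
    note A = grass_adjacent[OF g k_le_n a 3, folded w_def]
    let ?j = "inv w a"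
    have asc: "?j < inv w (Suc a)" using A(1) by simp
    have eq: "sref a \<circ> w = w \<circ> sref ?j"
    proof
      fix i
      have "w i = a \<longleftrightarrow> i = ?j" "w i = Suc a \<longleftrightarrow> i = Suc ?j"
        using permutes_inv_eq[OF w] A(1) by metis+
      moreover have "w ?j = a" "w (Suc ?j) = Suc a"
        using permutes_inverses(1)[OF w] A(1) by metis+
      ultimately show "(sref a \<circ> w) i = (w \<circ> sref ?j) i" by (auto simp: sref_apply)
    qed
    have "Tb a * Tbar n p q T w = Tbar n p q T w * Tb ?j"
      using Tbar_snoc[OF w a asc A(3) eq] Tbar_sref_up[OF w a asc] by simp
    then have "Tb a * P S = Tbar n p q T w * (Tb ?j * Sig)"
      by (simp add: P_def w_def mult.assoc[symmetric])
    also have "\<dots> = p * P S"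
      unfolding Tb_Sig[OF A(3,2)] by (simp add: P_def w_def central_left_commute[OF central_p])
    finally show ?thesis using 3 by (simp add: tau_def)
  qed
qed

lemma P_initial: "P {1..k} = Sig"
proof -
  have "grass n k id {1..k}" by (auto simp: grass_def permutes_id)
  from grass_eq_grass_perm[OF this k_le_n] show ?thesis by (simp add: P_def Tbar_id)
qed

end

section \<open>Jumps of particles\<close>

context hecke
begin

definition wt :: "nat set \<Rightarrow> nat \<Rightarrow> nat \<Rightarrow> 'a" where
  "wt U s t = p ^ card (U \<inter> {t<..<s}) * q ^ card ({t<..<s} - U)"

text \<open>Replacing the element s of U by a smaller t outside U corresponds to removing a ribbon.\<close>
definition jump :: "nat \<Rightarrow> (nat set \<Rightarrow> 'a) \<Rightarrow> nat set \<Rightarrow> 'a" where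
  "jump s g U = (\<Sum>t\<in>{1..<s} - U. wt U s t * g (insert t (U - {s})))"

text \<open>The e_r-expansion of P U when only the elements of U listed in L (in increasing order)
  may be selected; each of them stays or jumps.\<close>
primrec expand :: "nat \<Rightarrow> nat list \<Rightarrow> nat set \<Rightarrow> 'a" where
  "expand r [] U = (if r = 0 then P U else 0)"
| "expand r (s # L) U = expand r L U +
     (case r of 0 \<Rightarrow> 0 | Suc r' \<Rightarrow> x s * expand r' L U + xfac s * jump s (expand r' L) U)"

lemma central_wt: "central (wt U s t)"
  unfolding wt_def by (intro central_mult central_power central_p central_q)

lemma tau_add: "tau a (\<lambda>U. f U + g U) U = tau a f U + tau a g U"
  by (simp add: tau_def algebra_simps)

lemma tau_mult: "tau a (\<lambda>U. c * g U) U = c * tau a g U"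
  by (simp add: tau_def distrib_left mult.assoc central_left_commute[OF central_pq, of c]
      central_left_commute[OF central_p, of c] central_left_commute[OF central_q, of c])

lemma mult_jump: "c * jump s g U = jump s (\<lambda>V. c * g V) U"
  by (simp add: jump_def sum_distrib_left central_left_commute[OF central_wt, of c])

lemma jump_cong:
  assumes "\<And>t. t \<in> {1..<s} - U \<Longrightarrow> f (insert t (U - {s})) = g (insert t (U - {s}))"
  shows "jump s f U = jump s g U"
  unfolding jump_def using assms by (intro sum.cong) auto

lemma wt_cong: "U \<inter> {t<..<s} = V \<inter> {t<..<s} \<Longrightarrow> wt U s t = wt V s t"
proof -
  assume "U \<inter> {t<..<s} = V \<inter> {t<..<s}"
  moreover have "{t<..<s} - W = {t<..<s} - (W \<inter> {t<..<s})" for W by blast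
  ultimately show ?thesis unfolding wt_def by metis
qed

lemma wt_left:
  assumes "Suc a < s"
  shows "wt U s a = (if Suc a \<in> U then p else q) * wt U s (Suc a)"
proof -
  have I: "{a<..<s} = insert (Suc a) {Suc a<..<s}" using assms by auto
  show ?thesis
  proof (cases "Suc a \<in> U")
    case True
    then have "U \<inter> {a<..<s} = insert (Suc a) (U \<inter> {Suc a<..<s})"
        "{a<..<s} - U = {Suc a<..<s} - U"
      unfolding I by auto
    then show ?thesis using True by (simp add: wt_def mult.assoc)
  next
    case False
    then have "{a<..<s} - U = insert (Suc a) ({Suc a<..<s} - U)"
        "U \<inter> {a<..<s} = U \<inter> {Suc a<..<s}"
      unfolding I by auto
    then show ?thesis using False by (simp add: wt_def central_left_commute[OF central_q])
  qed
qed

lemma wt_right: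
  assumes "t < a"
  shows "wt U (Suc a) t = (if a \<in> U then p else q) * wt U a t"
proof -
  have I: "{t<..<Suc a} = insert a {t<..<a}" using assms by auto
  show ?thesis
  proof (cases "a \<in> U")
    case True
    then have "U \<inter> {t<..<Suc a} = insert a (U \<inter> {t<..<a})" "{t<..<Suc a} - U = {t<..<a} - U"
      unfolding I by auto
    then show ?thesis using True by (simp add: wt_def mult.assoc)
  next
    case False
    then have "{t<..<Suc a} - U = insert a ({t<..<a} - U)" "U \<inter> {t<..<Suc a} = U \<inter> {t<..<a}"
      unfolding I by auto
    then show ?thesis using False by (simp add: wt_def central_left_commute[OF central_q])
  qed
qed

text \<open>Both \<open>a\<close> and \<open>Suc a\<close> lie in the interval between
  \<open>t\<close> and \<open>s\<close>, or neither does, so moving a particle from one to the other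
  changes neither count.\<close>

lemma wt_swap:
  assumes "Suc a < s" "t \<noteq> a" "t \<noteq> Suc a" "a \<in> U" "Suc a \<notin> U"
  shows "wt (insert (Suc a) (U - {a})) s t = wt U s t"
proof (cases "t < a")
  case True
  let ?I = "{t<..<s}" and ?V = "insert (Suc a) (U - {a})"
  have "?V \<inter> ?I = insert (Suc a) (U \<inter> ?I - {a})" "?I - ?V = insert a (?I - U - {Suc a})"
    using assms True by auto
  moreover have "a \<in> U \<inter> ?I" "Suc a \<in> ?I - U" using assms True by auto
  ultimately have "card (?V \<inter> ?I) = card (U \<inter> ?I)" "card (?I - ?V) = card (?I - U)"
    using assms card_Suc_Diff1[of "U \<inter> ?I" a] card_Suc_Diff1[of "?I - U" "Suc a"] by auto
  then show ?thesis by (simp add: wt_def)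
next
  case False
  then show ?thesis using assms by (intro wt_cong) auto
qed

text \<open>Isolates the landing places \<open>a\<close> and \<open>Suc a\<close>, the only ones
  that can change which case of \<open>tau a\<close> applies.\<close>

lemma jump_split:
  assumes "1 \<le> a" "Suc a < s"
  shows "jump s g U = (\<Sum>t\<in>{1..<s} - {a, Suc a} - U. wt U s t * g (insert t (U - {s})))
    + (if a \<in> U then 0 else wt U s a * g (insert a (U - {s})))
    + (if Suc a \<in> U then 0 else wt U s (Suc a) * g (insert (Suc a) (U - {s})))"
proof -
  let ?R = "{1..<s} - {a, Suc a} - U"
  define f where "f t = wt U s t * g (insert t (U - {s}))" for t
  have single: "sum f ({c} - U) = (if c \<in> U then 0 else f c)" for c
    by (simp add: insert_Diff_if)
  have "{1..<s} - U = ?R \<union> ({a} - U) \<union> ({Suc a} - U)" using assms by auto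
  then have "sum f ({1..<s} - U) = sum f (?R \<union> ({a} - U) \<union> ({Suc a} - U))" by (rule arg_cong)
  also have "\<dots> = sum f (?R \<union> ({a} - U)) + sum f ({Suc a} - U)"
    by (rule sum.union_disjoint) auto
  also have "sum f (?R \<union> ({a} - U)) = sum f ?R + sum f ({a} - U)"
    by (rule sum.union_disjoint) auto
  finally show ?thesis unfolding single unfolding jump_def f_def .
qed

text \<open>For landing places other than \<open>a\<close> and \<open>Suc a\<close>, the case of
  \<open>tau a\<close> is the same before and after the jump, and the weights agree by
  \<open>wt_swap\<close>. The two special landing places are compared by hand, their weights
  differing by a factor \<open>p\<close> or \<open>q\<close> according to
  \<open>wt_left\<close>.\<close>

lemma jump_tau:
  assumes a: "1 \<le> a" and s: "Suc a < s"
  shows "jump s (tau a g) U = tau a (jump s g) U"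
proof -
  let ?R = "{1..<s} - {a, Suc a}"
  define X where "X f V = (\<Sum>t\<in>?R - V. wt V s t * f (insert t (V - {s})))" for f and V :: "nat set"
  note split = jump_split[OF a s, folded X_def]
  \<comment> \<open>This weight sees only the part of the set above \<open>Suc a\<close>, so it is
    unchanged when a particle moves between \<open>a\<close> and \<open>Suc a\<close>.\<close>
  define m where "m = wt U s (Suc a)"
  have m: "wt V s (Suc a) = m" if "V \<inter> {Suc a<..<s} = U \<inter> {Suc a<..<s}" for V
    unfolding m_def using that by (rule wt_cong)
  have cm: "central m" unfolding m_def by (rule central_wt)
  have mult_X: "X (\<lambda>V. c * f V) V = c * X f V" for c f V
    by (simp add: X_def sum_distrib_left central_left_commute[OF central_wt, of c])
  have X_add: "X (\<lambda>V. e V + f V) V = X e V + X f V" for e f V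
    by (simp add: X_def distrib_left sum.distrib)
  have X_cong: "X e V = X f V" if "\<And>t. t \<in> ?R - V \<Longrightarrow> e (insert t (V - {s})) = f (insert t (V - {s}))"
    for e f V
    unfolding X_def using that by (intro sum.cong) auto
  have X_swap: "X f (insert (Suc a) (V - {a})) = X (\<lambda>W. f (insert (Suc a) (W - {a}))) V"
    if "a \<in> V" "Suc a \<notin> V" for f V
    unfolding X_def
  proof (rule sum.cong)
    show "?R - insert (Suc a) (V - {a}) = ?R - V" by auto
    fix t assume t: "t \<in> ?R - V"
    have "insert t (insert (Suc a) (V - {a}) - {s}) = insert (Suc a) (insert t (V - {s}) - {a})"
      using s t by auto
    then show "wt (insert (Suc a) (V - {a})) s t * f (insert t (insert (Suc a) (V - {a}) - {s})) =
        wt V s t * f (insert (Suc a) (insert t (V - {s}) - {a}))"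
      using wt_swap[OF s, of t V] t that by simp
  qed
  note norm = mult.assoc central_left_commute[OF cm, of p] central_left_commute[OF cm, of q]
    central_left_commute[OF central_p, of q] central_commute[OF central_p, of q]
    distrib_left left_diff_distrib
  consider (up) "a \<in> U" "Suc a \<notin> U" | (down) "a \<notin> U" "Suc a \<in> U"
    | (both) "a \<in> U" "Suc a \<in> U" | (none) "a \<notin> U" "Suc a \<notin> U" by blast
  then show ?thesis
  proof cases
    case up
    let ?V = "insert (Suc a) (U - {a})"
    have "X (tau a g) U = X g ?V"
      unfolding X_swap[OF up] by (rule X_cong) (use up s in \<open>auto simp: tau_def\<close>)
    moreover have "tau a g (insert (Suc a) (U - {s})) = p * g (insert (Suc a) (U - {s}))"
      using up s by (auto simp: tau_def)
    moreover have "insert a (?V - {s}) = insert (Suc a) (U - {s})" using up s by auto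
    moreover have "wt ?V s (Suc a) = m" by (rule m) auto
    ultimately show ?thesis
      using up unfolding tau_def[of a "jump s g"] split
      by (simp add: wt_left[OF s] m_def[symmetric] norm)
  next
    case down
    \<comment> \<open>With \<open>W\<close> the set after landing on \<open>a\<close>, which
      contains both \<open>a\<close> and \<open>Suc a\<close>, the special terms agree because
      \<open>p * p = (p - q) * p + p * q\<close>; each side contributes this times
      \<open>m * g W\<close>.\<close>
    let ?V = "insert a (U - {Suc a})"
    have U: "insert (Suc a) (?V - {a}) = U" using down by auto
    have "X (tau a g) U = X (\<lambda>W. (p - q) * g W + p * q * g (insert a (W - {Suc a}))) U"
      by (rule X_cong) (use down s in \<open>auto simp: tau_def\<close>)
    also have "\<dots> = (p - q) * X g U + p * q * X (\<lambda>W. g (insert a (W - {Suc a}))) U"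
      by (simp add: X_add mult_X)
    also have "X (\<lambda>W. g (insert a (W - {Suc a}))) U = X g ?V"
    proof -
      have "X (\<lambda>W. g (insert a (W - {Suc a}))) (insert (Suc a) (?V - {a}))
          = X (\<lambda>W. g (insert a (insert (Suc a) (W - {a}) - {Suc a}))) ?V"
        by (rule X_swap) auto
      also have "\<dots> = X g ?V"
        by (rule X_cong) (use s in \<open>auto intro!: arg_cong[of _ _ g]\<close>)
      finally show ?thesis unfolding U .
    qed
    finally have "X (tau a g) U = (p - q) * X g U + p * q * X g ?V" .
    moreover have "tau a g (insert a (U - {s})) = p * g (insert a (U - {s}))"
      using down s by (auto simp: tau_def)
    moreover have "insert (Suc a) (?V - {s}) = insert a (U - {s})" using down s by auto
    moreover have "wt ?V s (Suc a) = m" by (rule m) auto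
    ultimately show ?thesis
      using down unfolding tau_def[of a "jump s g"] split
      by (simp add: wt_left[OF s] m_def[symmetric] norm)
  next
    case both
    have "X (tau a g) U = X (\<lambda>W. p * g W) U"
      by (rule X_cong) (use both s in \<open>auto simp: tau_def\<close>)
    then show ?thesis
      using both unfolding tau_def[of a "jump s g"] split by (simp add: mult_X)
  next
    case none
    \<comment> \<open>Here both special landing places are free. The weight at \<open>a\<close> is
      \<open>q * m\<close>, and its contribution combines with the \<open>p - q\<close> from landing
      on \<open>Suc a\<close> to give the coefficient \<open>p * m\<close>, as on the right.\<close>
    have "X (tau a g) U = X (\<lambda>W. p * g W) U"
      by (rule X_cong) (use none s in \<open>auto simp: tau_def\<close>)
    moreover have "insert (Suc a) (insert a (U - {s}) - {a}) = insert (Suc a) (U - {s})"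
        "insert a (insert (Suc a) (U - {s}) - {Suc a}) = insert a (U - {s})"
      using none by auto
    then have "tau a g (insert a (U - {s})) = g (insert (Suc a) (U - {s}))"
        "tau a g (insert (Suc a) (U - {s})) =
           (p - q) * g (insert (Suc a) (U - {s})) + p * q * g (insert a (U - {s}))"
      using none s by (auto simp: tau_def)
    ultimately show ?thesis
      using none unfolding tau_def[of a "jump s g"] split
      by (simp add: wt_left[OF s] m_def[symmetric] norm right_diff_distrib mult_X)
  qed
qed

section \<open>Left multiplication of partial expansions by \<open>Tb a\<close>\<close>

lemma jump_valid:
  assumes "U \<subseteq> {1..n}" "card U = k" "s \<in> U" "t \<in> {1..<s} - U"
  shows "insert t (U - {s}) \<subseteq> {1..n}" "card (insert t (U - {s})) = k"
proof -
  have fin: "finite U" using assms(1) by (rule finite_subset) simp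
  show "insert t (U - {s}) \<subseteq> {1..n}" using assms by auto
  show "card (insert t (U - {s})) = k"
    using assms fin card_Suc_Diff1[OF fin assms(3)] by simp
qed

text \<open>\<open>Tb a\<close> commutes with \<open>x s\<close> and \<open>xfac s\<close> for
  \<open>s > Suc a\<close>, and \<open>jump_tau\<close> handles the jumps, which reduces the claim
  to \<open>Tb_P\<close>. The induction must vary \<open>U\<close>, since jumps alter it and may
  land on \<open>a\<close> or \<open>Suc a\<close>.\<close>

lemma Tb_expand_above:
  assumes a: "a \<in> {1..<n}" and "U \<subseteq> {1..n}" "card U = k" "set L \<subseteq> U" "sorted_wrt (<) L"
    and "\<And>s. s \<in> set L \<Longrightarrow> Suc a < s"
  shows "Tb a * expand r L U = tau a (expand r L) U"
  using assms(2-)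
proof (induction L arbitrary: r U)
  case Nil
  have "expand r [] = (if r = 0 then P else (\<lambda>_. 0))" by auto
  moreover have "tau a (\<lambda>_. 0) U = 0" by (simp add: tau_def)
  ultimately show ?case using Tb_P[OF a Nil.prems(1,2)] by (auto simp del: expand.simps)
next
  case (Cons s L)
  have s: "s \<in> {1..n}" "s \<in> U" "Suc a < s" "s \<notin> set L" and a1: "1 \<le> a"
    using Cons.prems a by auto
  have IH: "Tb a * expand r' L U = tau a (expand r' L) U" for r' using Cons by auto
  have Tx: "Tb a * (x s * y) = x s * (Tb a * y)" "Tb a * (xfac s * y) = xfac s * (Tb a * y)" for y
    using Tb_x_far[OF a s(1)] Tb_xfac_far[OF a s(1)] s(3) by (simp_all add: mult.assoc[symmetric])
  have "Tb a * jump s (expand r' L) U = tau a (jump s (expand r' L)) U" for r'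
  proof -
    have "Tb a * jump s (expand r' L) U = jump s (tau a (expand r' L)) U"
      unfolding mult_jump
    proof (rule jump_cong)
      fix t assume t: "t \<in> {1..<s} - U"
      show "Tb a * expand r' L (insert t (U - {s})) = tau a (expand r' L) (insert t (U - {s}))"
        by (rule Cons.IH[OF jump_valid[OF Cons.prems(1,2) s(2) t]]) (use Cons.prems s in auto)
    qed
    then show ?thesis unfolding jump_tau[OF a1 s(3)] .
  qed
  then show ?case using IH Tx
    by (cases r) (simp_all add: tau_add tau_mult distrib_left)
qed

text \<open>After a jump of \<open>a\<close> to some \<open>t < a\<close>, neither \<open>a\<close>
  nor \<open>Suc a\<close> is occupied. There \<open>Tb a\<close> acts by \<open>p\<close>, so the
  factor \<open>Tb a - (p - q)\<close> from \<open>Tb_xfac_left\<close> acts by \<open>q\<close>,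
  matching the new hole \<open>a\<close> that a jump from \<open>Suc a\<close> passes.\<close>

lemma Tb_expand_at:
  assumes a: "a \<in> {1..<n}" and U: "U \<subseteq> {1..n}" "card U = k" and L: "set L \<subseteq> U" "sorted_wrt (<) L"
    and gt: "\<And>s. s \<in> set L \<Longrightarrow> Suc a < s" and aU: "a \<in> U" "Suc a \<notin> U"
  shows "Tb a * expand r (a # L) U = expand r (Suc a # L) (insert (Suc a) (U - {a}))"
proof -
  let ?V = "insert (Suc a) (U - {a})"
  have up: "Tb a * expand r' L U = expand r' L ?V" for r'
    using Tb_expand_above[OF a U L gt] aU by (simp add: tau_def)
  have 1: "Tb a * (x a * expand r' L U) = x (Suc a) * expand r' L ?V + xfac (Suc a) * expand r' L U" for r'
    by (simp add: mult.assoc[symmetric] Tb_x_left[OF a] distrib_right) (simp add: mult.assoc up)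
  have 2: "Tb a * jump a (expand r' L) U = p * jump a (expand r' L) U" for r'
    unfolding mult_jump
  proof (rule jump_cong)
    fix t assume t: "t \<in> {1..<a} - U"
    have "Tb a * expand r' L (insert t (U - {a})) = tau a (expand r' L) (insert t (U - {a}))"
      by (rule Tb_expand_above[OF a jump_valid[OF U aU(1) t]]) (use L gt in force)+
    then show "Tb a * expand r' L (insert t (U - {a})) = p * expand r' L (insert t (U - {a}))"
      using t aU by (auto simp: tau_def)
  qed
  have 3: "Tb a * (xfac a * jump a (expand r' L) U) = xfac (Suc a) * (q * jump a (expand r' L) U)" for r'
  proof -
    have "Tb a * (xfac a * jump a (expand r' L) U)
        = xfac (Suc a) * (Tb a * jump a (expand r' L) U - (p - q) * jump a (expand r' L) U)"
      by (simp add: mult.assoc[symmetric] Tb_xfac_left[OF a]) (simp add: mult.assoc left_diff_distrib)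
    then show ?thesis unfolding 2 by (simp add: left_diff_distrib)
  qed
  \<comment> \<open>The landing place \<open>a\<close> gives back \<open>U\<close> with weight 1,
    the interval between being empty. Every other landing place has the one additional hole
    \<open>a\<close> in its interval.\<close>
  have 4: "jump (Suc a) g ?V = g U + q * jump a g U" for g
  proof -
    have "{1..<Suc a} - ?V = insert a ({1..<a} - U)" using a by auto
    then have "jump (Suc a) g ?V = wt ?V (Suc a) a * g (insert a (?V - {Suc a}))
        + (\<Sum>t\<in>{1..<a} - U. wt ?V (Suc a) t * g (insert t (?V - {Suc a})))"
      unfolding jump_def by simp
    moreover have "insert a (?V - {Suc a}) = U" "?V - {Suc a} = U - {a}" using aU by auto
    moreover have "wt ?V (Suc a) a = 1"
    proof -
      have "{a<..<Suc a} = {}" by auto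
      then show ?thesis by (simp add: wt_def)
    qed
    moreover have "wt ?V (Suc a) t = q * wt U a t" if "t \<in> {1..<a} - U" for t
    proof -
      have "wt ?V a t = wt U a t" by (rule wt_cong) auto
      then show ?thesis using wt_right[of t a ?V] that by simp
    qed
    ultimately show ?thesis by (simp add: jump_def sum_distrib_left mult.assoc)
  qed
  show ?thesis
    using up 1 3 by (cases r) (simp_all add: distrib_left 4)
qed

text \<open>The elements listed before \<open>a\<close> jump only to places below \<open>a\<close>.
  Such jumps neither meet \<open>a\<close> and \<open>Suc a\<close> nor have them in their
  intervals, so \<open>Tb a\<close> passes through unchanged.\<close>

lemma Tb_expand:
  assumes a: "a \<in> {1..<n}" and "U \<subseteq> {1..n}" "card U = k" "set (L @ a # M) \<subseteq> U"
    "sorted_wrt (<) (L @ a # M)" "Suc a \<notin> U"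
  shows "Tb a * expand r (L @ a # M) U = expand r (L @ Suc a # M) (insert (Suc a) (U - {a}))"
  using assms(2-)
proof (induction L arbitrary: r U)
  case Nil
  have "Suc a < s" if "s \<in> set M" for s
    using that Nil.prems by (metis Suc_lessI append_Nil list.set_intros(2) sorted_wrt.simps(2) subsetD)
  then show ?case using Tb_expand_at[OF a Nil.prems(1,2)] Nil.prems by simp
next
  case (Cons s L)
  let ?V = "\<lambda>U. insert (Suc a) (U - {a})"
  have s: "s \<in> {1..n}" "s \<in> U" "s < a" "s \<notin> set (L @ a # M)"
    using Cons.prems by auto
  have IH: "Tb a * expand r' (L @ a # M) U = expand r' (L @ Suc a # M) (?V U)" for r'
    using Cons by auto
  have Tx: "Tb a * (x s * y) = x s * (Tb a * y)" "Tb a * (xfac s * y) = xfac s * (Tb a * y)" for y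
    using Tb_x_far[OF a s(1)] Tb_xfac_far[OF a s(1)] s(3) by (simp_all add: mult.assoc[symmetric])
  have "Tb a * jump s (expand r' (L @ a # M)) U = jump s (expand r' (L @ Suc a # M)) (?V U)" for r'
    unfolding mult_jump unfolding jump_def
  proof (rule sum.cong)
    show D: "{1..<s} - U = {1..<s} - ?V U" using s by auto
    fix t assume "t \<in> {1..<s} - ?V U"
    then have t: "t \<in> {1..<s} - U" unfolding D .
    have "Tb a * expand r' (L @ a # M) (insert t (U - {s}))
        = expand r' (L @ Suc a # M) (?V (insert t (U - {s})))"
      by (rule Cons.IH[OF jump_valid[OF Cons.prems(1,2) s(2) t]]) (use Cons.prems s t in auto)
    moreover have "?V (insert t (U - {s})) = insert t (?V U - {s})" using s t by auto
    moreover have "wt U s t = wt (?V U) s t" by (rule wt_cong) (use s in auto)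
    ultimately show "wt U s t * (Tb a * expand r' (L @ a # M) (insert t (U - {s})))
        = wt (?V U) s t * expand r' (L @ Suc a # M) (insert t (?V U - {s}))" by simp
  qed
  then show ?case using IH Tx by (cases r) (simp_all add: distrib_left)
qed

lemma expand_initial: "set L \<subseteq> {1..k} \<Longrightarrow> expand r L {1..k} = elem_sym x r L * P {1..k}"
proof (induction L arbitrary: r)
  case (Cons s L)
  then have "{1..<s} - {1..k} = {}" by auto
  then have "jump s g {1..k} = 0" for g by (simp only: jump_def sum.empty)
  then show ?case using Cons by (cases r) (simp_all add: distrib_right mult.assoc)
qed simp

lemma initial_set:
  assumes "S \<subseteq> {1..n}" "card S = k" "\<And>a. 1 \<le> a \<Longrightarrow> Suc a \<in> S \<Longrightarrow> a \<in> S"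
  shows "S = {1..k}"
proof (cases "S = {}")
  case True
  then show ?thesis using assms(2) by auto
next
  case False
  have fin: "finite S" using assms(1) by (rule finite_subset) simp
  have down: "j \<in> S" if "1 \<le> j" "j \<le> m" "m \<in> S" for j m
    using that(2,3,1)
  proof (induction rule: inc_induct)
    case (step i)
    then show ?case using assms(3)[of i] by auto
  qed simp
  have "S = {1..Max S}"
    using down[OF _ _ Max_in[OF fin False]] Max_ge[OF fin] assms(1) by auto
  then show ?thesis using assms(2) by (metis card_atLeastAtMost diff_Suc_1)
qed

text \<open>Induction on the sum of the elements, which drops by one when \<open>Suc a\<close> is
  replaced by a free \<open>a\<close>. Because \<open>Tb a\<close> acts from the left and the
  symmetric polynomial from the right, the two actions do not interfere.\<close>

lemma P_elem_sym:
  assumes "S \<subseteq> {1..n}" "card S = k"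
  shows "P S * elem_sym x r [1..<Suc k] = expand r (sorted_list_of_set S) S"
  using assms
proof (induction "\<Sum>S" arbitrary: S rule: less_induct)
  case less
  note S = less.prems
  have fin: "finite S" using S(1) by (rule finite_subset) simp
  show ?case
  proof (cases "\<exists>a\<ge>1. Suc a \<in> S \<and> a \<notin> S")
    case False
    then have S1: "S = {1..k}" using initial_set[OF S] by blast
    have "P {1..k} * elem_sym x r [1..<Suc k] = elem_sym x r [1..<Suc k] * P {1..k}"
      unfolding P_initial by (rule Sig_elem_sym)
    also have "\<dots> = expand r [1..<Suc k] {1..k}"
      by (rule expand_initial[symmetric]) auto
    finally have "P {1..k} * elem_sym x r [1..<Suc k] = expand r [1..<Suc k] {1..k}" .
    moreover have sl: "[1..<Suc k] = sorted_list_of_set {1..k}"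
      by (rule strict_sorted_equal) (auto simp del: upt_Suc)
    ultimately show ?thesis unfolding S1 sl[symmetric] by argo
  next
    case True
    then obtain a where a: "1 \<le> a" "Suc a \<in> S" "a \<notin> S" by blast
    then have a1: "a \<in> {1..<n}" using S(1) by auto
    let ?U = "insert a (S - {Suc a})"
    have U: "?U \<subseteq> {1..n}" "card ?U = k"
      by (rule jump_valid[OF S a(2)]; use a in simp)+
    have "\<Sum>S = Suc a + \<Sum>(S - {Suc a})" using fin a(2) by (rule sum.remove)
    moreover have "\<Sum>?U = a + \<Sum>(S - {Suc a})" using fin a(3) by (intro sum.insert) auto
    ultimately have lt: "\<Sum>?U < \<Sum>S" by linarith
    obtain L M where LM: "sorted_list_of_set S = L @ Suc a # M"
      using split_list[of "Suc a" "sorted_list_of_set S"] fin a(2) by auto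
    have srt: "sorted_wrt (<) (L @ Suc a # M)" unfolding LM[symmetric] by simp
    have set_S: "set (L @ Suc a # M) = S" unfolding LM[symmetric] using fin by simp
    have La: "s < a" if "s \<in> set L" for s
    proof -
      have "s < Suc a" using srt that by (auto simp: sorted_wrt_append)
      moreover have "s \<in> S" using that unfolding set_S[symmetric] by simp
      then have "s \<noteq> a" using a(3) by blast
      ultimately show ?thesis by simp
    qed
    have srt': "sorted_wrt (<) (L @ a # M)"
      using srt La by (auto simp: sorted_wrt_append)
    have set_U: "set (L @ a # M) = ?U"
    proof -
      have "Suc a \<notin> set L \<union> set M" using srt by (auto simp: sorted_wrt_append)
      moreover have "S - {Suc a} = (set L \<union> set M) - {Suc a}" unfolding set_S[symmetric] by auto
      ultimately show ?thesis by simp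
    qed
    have LM': "sorted_list_of_set ?U = L @ a # M"
      using srt'
    proof (rule strict_sorted_equal)
      show "set (sorted_list_of_set ?U) = set (L @ a # M)" unfolding set_U
        by (rule sorted_list_of_set.set_sorted_key_list_of_set) (use fin in simp)
      show "sorted_wrt (<) (sorted_list_of_set ?U)"
        by (rule sorted_list_of_set.strict_sorted_key_list_of_set)
    qed
    have S_eq: "insert (Suc a) (?U - {a}) = S" and aU: "a \<in> ?U" "Suc a \<notin> ?U" using a by auto
    have "P S * elem_sym x r [1..<Suc k] = Tb a * (P ?U * elem_sym x r [1..<Suc k])"
      unfolding mult.assoc[symmetric] P_raise[OF a1 U aU] S_eq ..
    also have "\<dots> = Tb a * expand r (L @ a # M) ?U"
      unfolding less.hyps[OF lt U] LM' ..
    also have "\<dots> = expand r (L @ Suc a # M) S"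
      using Tb_expand[OF a1 U equalityD1[OF set_U] srt' aU(2)] unfolding S_eq .
    finally show ?thesis unfolding LM .
  qed
qed

end

section \<open>Ribbons as jumps\<close>

definition part_pos :: "nat \<Rightarrow> (nat \<Rightarrow> nat) \<Rightarrow> nat \<Rightarrow> nat" where
  "part_pos k \<nu> i = \<nu> i + k + 1 - i"

definition part_set :: "nat \<Rightarrow> (nat \<Rightarrow> nat) \<Rightarrow> nat set" where
  "part_set k \<nu> = part_pos k \<nu> ` {1..k}"

text \<open>The skew shape with rows i to j in which consecutive rows overlap in exactly one column.\<close>
definition ribbon_form :: "nat \<Rightarrow> nat \<Rightarrow> nat \<Rightarrow> (nat \<Rightarrow> nat) \<Rightarrow> (nat \<Rightarrow> nat) \<Rightarrow> bool" where
  "ribbon_form k i j \<mu> la \<longleftrightarrow> 1 \<le> i \<and> i \<le> j \<and> j \<le> k \<and>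
     (\<forall>l. l < i \<or> j < l \<longrightarrow> la l = \<mu> l) \<and>
     (\<forall>l. i \<le> l \<and> l < j \<longrightarrow> Suc (la l) = \<mu> (Suc l)) \<and> la j < \<mu> j"

lemma finite_box_parts: "finite (box_parts n k)"
proof (rule finite_subset)
  show "box_parts n k \<subseteq> {f. \<forall>i. (i \<in> {1..k} \<longrightarrow> f i \<in> {0..n - k}) \<and> (i \<notin> {1..k} \<longrightarrow> f i = 0)}"
    by (auto simp: box_parts_def not_le)
qed (rule finite_set_of_finite_funs; simp)

lemma box_parts_antimono:
  assumes "\<mu> \<in> box_parts n k" "1 \<le> l" "l \<le> m"
  shows "\<mu> m \<le> \<mu> l"
  using assms(3)
proof (induction rule: dec_induct)
  case (step m)
  then have "\<mu> (Suc m) \<le> \<mu> m"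
    using assms(1,2) by (cases "m < k") (auto simp: box_parts_def)
  then show ?case using step.IH by simp
qed simp

lemma part_pos_strict:
  assumes "\<mu> \<in> box_parts n k" "1 \<le> l" "l < m" "m \<le> k"
  shows "part_pos k \<mu> m < part_pos k \<mu> l"
  using box_parts_antimono[OF assms(1,2), of m] assms by (simp add: part_pos_def)

lemma part_pos_inj: "\<mu> \<in> box_parts n k \<Longrightarrow> inj_on (part_pos k \<mu>) {1..k}"
proof (rule linorder_inj_onI)
  fix l m assume "\<mu> \<in> box_parts n k" "l < m" "l \<in> {1..k}" "m \<in> {1..k}"
  then have "part_pos k \<mu> m < part_pos k \<mu> l" by (intro part_pos_strict) auto
  then show "part_pos k \<mu> l \<noteq> part_pos k \<mu> m" by simp
qed auto

lemma part_set_card: "\<mu> \<in> box_parts n k \<Longrightarrow> card (part_set k \<mu>) = k"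
  unfolding part_set_def by (subst card_image[OF part_pos_inj]) auto

lemma part_set_subset: "\<mu> \<in> box_parts n k \<Longrightarrow> k \<le> n \<Longrightarrow> part_set k \<mu> \<subseteq> {1..n}"
proof -
  assume mu: "\<mu> \<in> box_parts n k" and kn: "k \<le> n"
  have "part_pos k \<mu> i \<in> {1..n}" if "i \<in> {1..k}" for i
  proof -
    have "\<mu> i \<le> n - k" using mu by (simp add: box_parts_def)
    then show ?thesis using kn that by (auto simp: part_pos_def)
  qed
  then show ?thesis by (auto simp: part_set_def)
qed

lemma part_set_image: "(\<lambda>j. \<nu> (k + 1 - j) + j) ` {1..k} = part_set k \<nu>"
proof -
  have "{1..k} = (\<lambda>i. k + 1 - i) ` {1..k}"
  proof
    show "{1..k} \<subseteq> (\<lambda>i. k + 1 - i) ` {1..k}"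
    proof
      fix i assume "i \<in> {1..k}"
      then have "k + 1 - i \<in> {1..k}" "i = k + 1 - (k + 1 - i)" by auto
      then show "i \<in> (\<lambda>i. k + 1 - i) ` {1..k}" by (rule rev_image_eqI)
    qed
  qed auto
  then have "part_set k \<nu> = part_pos k \<nu> ` (\<lambda>i. k + 1 - i) ` {1..k}"
    unfolding part_set_def by simp
  also have "\<dots> = (\<lambda>j. \<nu> (k + 1 - j) + j) ` {1..k}"
    unfolding image_image by (rule image_cong) (auto simp: part_pos_def)
  finally show ?thesis ..
qed

lemma part_set_nth:
  assumes "\<nu> \<in> box_parts n k" "1 \<le> j" "j \<le> k"
  shows "\<nu> (k + 1 - j) + j = sorted_list_of_set (part_set k \<nu>) ! (j - 1)"
proof -
  have inc: "\<nu> (k + 1 - i) + i < \<nu> (k + 1 - m) + m" if "0 < i" "i < m" "m \<le> k" for i m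
  proof -
    have "\<nu> (k + 1 - i) \<le> \<nu> (k + 1 - m)"
      by (rule box_parts_antimono[OF assms(1)]) (use that in auto)
    then show ?thesis using that by linarith
  qed
  show ?thesis
    using nth_eq_increasing[of 0 k "\<lambda>j. \<nu> (k + 1 - j) + j" "part_set k \<nu>" j, OF inc]
      part_set_image[of \<nu> k] assms by simp
qed

lemma part_set_inj:
  assumes "\<mu> \<in> box_parts n k" "\<nu> \<in> box_parts n k" "part_set k \<mu> = part_set k \<nu>"
  shows "\<mu> = \<nu>"
proof
  fix i
  show "\<mu> i = \<nu> i"
  proof (cases "1 \<le> i \<and> i \<le> k")
    case True
    then have b: "1 \<le> k + 1 - i" "k + 1 - i \<le> k" and e: "k + 1 - (k + 1 - i) = i" by auto
    show ?thesis
      using part_set_nth[OF assms(1) b] part_set_nth[OF assms(2) b] assms(3) unfolding e by simp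
  next
    case False
    then show ?thesis using assms by (auto simp: box_parts_def not_le)
  qed
qed

lemma wperm_eq_grass_perm:
  assumes "\<nu> \<in> box_parts n k"
  shows "wperm n k \<nu> = grass_perm n k (part_set k \<nu>)"
proof
  fix j
  have "{\<nu> i + k + 1 - i |i. i \<in> {1..k}} = part_set k \<nu>"
    by (auto simp: part_set_def part_pos_def image_iff)
  then show "wperm n k \<nu> j = grass_perm n k (part_set k \<nu>) j"
    unfolding wperm_def grass_perm_def using part_set_nth[OF assms, of j] by simp
qed

lemma sorted_part_set:
  assumes "\<mu> \<in> box_parts n k"
  shows "map (part_pos k \<mu>) (rev [1..<Suc k]) = sorted_list_of_set (part_set k \<mu>)"
proof (rule strict_sorted_equal)
  show "sorted_wrt (<) (sorted_list_of_set (part_set k \<mu>))" by simp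
  have "sorted_wrt (\<lambda>l m. part_pos k \<mu> m < part_pos k \<mu> l) [1..<Suc k]"
    using part_pos_strict[OF assms] by (auto simp: sorted_wrt_iff_nth_less simp del: upt_Suc)
  then show "sorted_wrt (<) (map (part_pos k \<mu>) (rev [1..<Suc k]))"
    unfolding sorted_wrt_map sorted_wrt_rev .
  show "set (map (part_pos k \<mu>) (rev [1..<Suc k])) = set (sorted_list_of_set (part_set k \<mu>))"
    by (simp add: part_set_def atLeastLessThanSuc_atLeastAtMost del: upt_Suc)
qed

text \<open>A step between adjacent boxes changes the row by at most one, so a path that gets below
  row \<open>l\<close> must contain a vertical step from row \<open>l\<close> to row
  \<open>Suc l\<close>.\<close>

lemma ribbon_path_crosses:
  assumes "(a, b) \<in> {(c, d). c \<in> S \<and> d \<in> S \<and> box_adj c d}\<^sup>*" "fst a \<le> l" "l < fst b"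
  shows "\<exists>c. (l, c) \<in> S \<and> (Suc l, c) \<in> S"
  using assms(1,3)
proof (induction rule: rtrancl_induct)
  case base
  then show ?case using assms(2) by simp
next
  case (step y z)
  show ?case
  proof (cases "l < fst y")
    case True
    then show ?thesis using step.IH by blast
  next
    case False
    then have "fst y = l" "fst z = Suc l" "snd z = snd y"
      using step by (auto simp: box_adj_def)
    then show ?thesis using step.hyps(2) by (cases y; cases z) auto
  qed
qed

text \<open>Connectedness makes consecutive rows share at least one column, and the absence of a 2x2
  square makes them share at most one.\<close>

lemma ribbon_imp_form:
  assumes mu: "\<mu> \<in> box_parts n k" and la: "la \<in> box_parts n k" and rib: "is_ribbon \<mu> la"
  shows "\<exists>j. ribbon_form k (head_row \<mu> la) j \<mu> la"
proof -
  let ?S = "skew \<mu> la" and ?R = "fst ` skew \<mu> la"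
  have le: "la l \<le> \<mu> l" for l using rib by (simp add: is_ribbon_def)
  note rest = conjunct2[OF conjunct2[OF rib[unfolded is_ribbon_def]]]
  note conn = conjunct1[OF rest] and no_square = conjunct2[OF rest]
  have row: "l \<in> ?R \<longleftrightarrow> la l < \<mu> l" for l
  proof
    assume "la l < \<mu> l"
    then have "(l, \<mu> l) \<in> ?S" by (simp add: skew_def)
    then have "fst (l, \<mu> l) \<in> ?R" by (rule imageI)
    then show "l \<in> ?R" by simp
  qed (auto simp: skew_def)
  have R: "?R \<subseteq> {1..k}"
  proof
    fix l assume "l \<in> ?R"
    then have "\<mu> l \<noteq> 0" unfolding row by simp
    moreover have "\<mu> l = 0" if "l = 0 \<or> k < l" using mu that by (auto simp: box_parts_def)
    ultimately have "\<not> (l = 0 \<or> k < l)" by metis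
    then show "l \<in> {1..k}" by auto
  qed
  then have fin: "finite ?R" by (rule finite_subset) simp
  have ne: "?R \<noteq> {}" using rib by (simp add: is_ribbon_def)
  let ?i = "Min ?R" and ?j = "Max ?R"
  have i: "?i \<in> ?R" and j: "?j \<in> ?R" using Min_in[OF fin ne] Max_in[OF fin ne] by auto
  have out: "la l = \<mu> l" if "l < ?i \<or> ?j < l" for l
  proof -
    have "l \<notin> ?R" using that Min_le[OF fin, of l] Max_ge[OF fin, of l] by linarith
    then show ?thesis using row[of l] le[of l] by linarith
  qed
  have mid: "Suc (la l) = \<mu> (Suc l)" if l: "?i \<le> l" "l < ?j" for l
  proof -
    obtain a where a: "a \<in> ?S" "?i = fst a" using i by (rule imageE)
    obtain b where b: "b \<in> ?S" "?j = fst b" using j by (rule imageE)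
    have "(a, b) \<in> {(c, d). c \<in> ?S \<and> d \<in> ?S \<and> box_adj c d}\<^sup>*"
      by (rule bspec[OF bspec[OF conn a(1)] b(1)])
    from ribbon_path_crosses[OF this, of l] obtain c where c: "(l, c) \<in> ?S" "(Suc l, c) \<in> ?S"
      using l unfolding a(2) b(2) by blast
    then have lt: "la l < \<mu> (Suc l)" by (auto simp: skew_def)
    have l1: "1 \<le> l" using l(1) subsetD[OF R i] by simp
    have "la (Suc l) \<le> la l" "\<mu> (Suc l) \<le> \<mu> l"
      using box_parts_antimono[OF la l1] box_parts_antimono[OF mu l1] by auto
    \<comment> \<open>Otherwise the columns \<open>la l + 1\<close> and \<open>la l + 2\<close> in
      rows \<open>l\<close> and \<open>Suc l\<close> form a 2x2 square.\<close>
    moreover have "\<not> Suc (la l) < \<mu> (Suc l)"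
    proof
      assume "Suc (la l) < \<mu> (Suc l)"
      then have "(l, Suc (la l)) \<in> ?S \<and> (Suc l, Suc (la l)) \<in> ?S \<and>
          (l, Suc (Suc (la l))) \<in> ?S \<and> (Suc l, Suc (Suc (la l))) \<in> ?S"
        using calculation by (simp add: skew_def)
      then show False using no_square by (elim notE) (intro exI)
    qed
    ultimately show ?thesis using lt by simp
  qed
  have "ribbon_form k ?i ?j \<mu> la"
    unfolding ribbon_form_def
  proof (intro conjI allI impI)
    show "1 \<le> ?i" "?j \<le> k" using subsetD[OF R i] subsetD[OF R j] by simp_all
    show "?i \<le> ?j" by (rule Min_le[OF fin j])
    show "la ?j < \<mu> ?j" using j unfolding row .
  qed (use out mid in blast)+
  then show ?thesis unfolding head_row_def by (rule exI)
qed

section \<open>Geometry and positions of a shape in ribbon form\<close>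

context
  fixes n k i j :: nat and \<mu> la :: "nat \<Rightarrow> nat"
  assumes mu: "\<mu> \<in> box_parts n k" and la: "la \<in> box_parts n k"
    and form: "ribbon_form k i j \<mu> la"
begin

lemma form_bounds: "1 \<le> i" "i \<le> j" "j \<le> k" "la j < \<mu> j"
  using form by (auto simp: ribbon_form_def)

lemma form_out: "l < i \<or> j < l \<Longrightarrow> la l = \<mu> l"
  using form by (auto simp: ribbon_form_def)

lemma form_mid: "i \<le> l \<Longrightarrow> l < j \<Longrightarrow> Suc (la l) = \<mu> (Suc l)"
  using form by (auto simp: ribbon_form_def)

lemma form_less: "i \<le> l \<Longrightarrow> l \<le> j \<Longrightarrow> la l < \<mu> l"
  using form_mid[of l] box_parts_antimono[OF mu, of l "Suc l"] form_bounds
  by (cases "l = j") auto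

lemma form_skew_row: "(l, c) \<in> skew \<mu> la \<Longrightarrow> i \<le> l \<and> l \<le> j"
  using form_out[of l] by (force simp: skew_def)

lemma form_rows: "fst ` skew \<mu> la = {i..j}"
proof
  show "fst ` skew \<mu> la \<subseteq> {i..j}" using form_skew_row by auto
  show "{i..j} \<subseteq> fst ` skew \<mu> la"
  proof
    fix l assume "l \<in> {i..j}"
    then have "(l, \<mu> l) \<in> skew \<mu> la" using form_less by (simp add: skew_def)
    then show "l \<in> fst ` skew \<mu> la" by force
  qed
qed

lemma form_columns: "snd ` skew \<mu> la = {la j<..\<mu> i}"
proof
  show "snd ` skew \<mu> la \<subseteq> {la j<..\<mu> i}"
  proof
    fix c assume "c \<in> snd ` skew \<mu> la"
    then obtain l where l: "(l, c) \<in> skew \<mu> la" by force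
    then have "i \<le> l" "l \<le> j" using form_skew_row by auto
    then have "la j \<le> la l" "\<mu> l \<le> \<mu> i"
      using box_parts_antimono[OF la, of l j] box_parts_antimono[OF mu, of i l] form_bounds by auto
    then show "c \<in> {la j<..\<mu> i}" using l by (auto simp: skew_def)
  qed
  show "{la j<..\<mu> i} \<subseteq> snd ` skew \<mu> la"
  proof
    fix c assume c: "c \<in> {la j<..\<mu> i}"
    \<comment> \<open>The last row still reaching column \<open>c\<close>. The next row of
      \<open>\<mu>\<close> ends before \<open>c\<close>, and \<open>la l\<close> is one less than
      its length, so the box in row \<open>l\<close> is in the skew shape.\<close>
    define l where "l = Max {l \<in> {i..j}. c \<le> \<mu> l}"
    have "l \<in> {l \<in> {i..j}. c \<le> \<mu> l}"
      unfolding l_def using c form_bounds by (intro Max_in) auto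
    then have l: "i \<le> l" "l \<le> j" "c \<le> \<mu> l" by auto
    have "la l < c"
    proof (cases "l = j")
      case True
      then show ?thesis using c by simp
    next
      case False
      have "\<not> c \<le> \<mu> (Suc l)"
      proof
        assume "c \<le> \<mu> (Suc l)"
        then have "Suc l \<le> l" unfolding l_def[symmetric]
          using l False by (subst (2) l_def, intro Max_ge) auto
        then show False by simp
      qed
      then show ?thesis using form_mid[of l] l False by simp
    qed
    then have "(l, c) \<in> skew \<mu> la" using l by (simp add: skew_def)
    then show "c \<in> snd ` skew \<mu> la" by force
  qed
qed

lemma form_head_row: "head_row \<mu> la = i"
  unfolding head_row_def form_rows using form_bounds(2) by (intro Min_eqI) auto

lemma form_ht: "ribbon_ht \<mu> la - 1 = j - i"
  by (simp add: ribbon_ht_def form_rows)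

lemma form_wd: "ribbon_wd \<mu> la - 1 = \<mu> i - la j - 1"
  by (simp add: ribbon_wd_def form_columns)

text \<open>Every box is joined to the head: go right to the end of the row, then up in the column
  \<open>\<mu> (Suc l)\<close> shared with the row above, and repeat.\<close>

lemma form_is_ribbon: "is_ribbon \<mu> la"
proof -
  let ?S = "skew \<mu> la"
  let ?E = "{(c, d). c \<in> ?S \<and> d \<in> ?S \<and> box_adj c d}"
  have le: "la l \<le> \<mu> l" for l
    using form_out[of l] form_less[of l] by (cases "i \<le> l \<and> l \<le> j") auto
  have "sym ?E" by (auto simp: sym_def box_adj_def)
  then have sym: "(b, a) \<in> ?E\<^sup>*" if "(a, b) \<in> ?E\<^sup>*" for a b
    using that by (meson sym_rtrancl symD)
  have row_end: "((l, c), (l, \<mu> l)) \<in> ?E\<^sup>*" if "(l, c) \<in> ?S" for l c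
  proof -
    have "c \<le> \<mu> l" "la l < c" using that by (auto simp: skew_def)
    then show ?thesis
    proof (induction rule: inc_induct)
      case (step c)
      then have "((l, c), (l, Suc c)) \<in> ?E" by (auto simp: skew_def box_adj_def)
      then show ?case using step by (meson converse_rtrancl_into_rtrancl less_SucI)
    qed simp
  qed
  have top: "((l, \<mu> l), (i, \<mu> i)) \<in> ?E\<^sup>*" if "i \<le> l" "l \<le> j" for l
    using that
  proof (induction rule: dec_induct)
    case (step l)
    have mid: "Suc (la l) = \<mu> (Suc l)" using form_mid step by simp
    have a: "(Suc l, \<mu> (Suc l)) \<in> ?S" using form_less[of "Suc l"] step by (simp add: skew_def)
    have b: "(l, \<mu> (Suc l)) \<in> ?S"
      using mid form_less[of l] step by (simp add: skew_def)
    have "((Suc l, \<mu> (Suc l)), (l, \<mu> (Suc l))) \<in> ?E" using a b by (simp add: box_adj_def)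
    moreover have "((l, \<mu> (Suc l)), (l, \<mu> l)) \<in> ?E\<^sup>*" by (rule row_end[OF b])
    moreover have "((l, \<mu> l), (i, \<mu> i)) \<in> ?E\<^sup>*" using step by simp
    ultimately show ?case by (meson converse_rtrancl_into_rtrancl rtrancl_trans)
  qed simp
  have all: "(a, (i, \<mu> i)) \<in> ?E\<^sup>*" if "a \<in> ?S" for a
  proof -
    obtain l c where a: "a = (l, c)" by (cases a)
    then show ?thesis
      using rtrancl_trans[OF row_end top] that form_skew_row by blast
  qed
  have conn: "(a, b) \<in> ?E\<^sup>*" if "a \<in> ?S" "b \<in> ?S" for a b
    using rtrancl_trans[OF all[OF that(1)] sym[OF all[OF that(2)]]] .
  have "\<not> (\<exists>l c. (l, c) \<in> ?S \<and> (Suc l, c) \<in> ?S \<and> (l, Suc c) \<in> ?S \<and> (Suc l, Suc c) \<in> ?S)"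
  proof clarify
    fix l c assume a: "(l, c) \<in> ?S" "(Suc l, Suc c) \<in> ?S"
    then have "i \<le> l" "l < j" using form_skew_row[OF a(1)] form_skew_row[OF a(2)] by auto
    then show False using form_mid[of l] a by (auto simp: skew_def)
  qed
  moreover have "?S \<noteq> {}" using form_rows form_bounds(2) by force
  ultimately show ?thesis using le conn unfolding is_ribbon_def by blast
qed

lemma form_pos_shift: "i \<le> l \<Longrightarrow> l < j \<Longrightarrow> part_pos k la l = part_pos k \<mu> (Suc l)"
  using form_mid[of l] form_bounds by (simp add: part_pos_def)

lemma form_pos_out: "l < i \<or> j < l \<Longrightarrow> part_pos k la l = part_pos k \<mu> l"
  by (simp add: part_pos_def form_out)

lemma form_pos_less: "l \<in> {1..k} \<Longrightarrow> l \<le> j \<Longrightarrow> part_pos k la j < part_pos k \<mu> l"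
  using box_parts_antimono[OF mu, of l j] form_bounds by (auto simp: part_pos_def)

lemma form_pos_greater: "l \<in> {1..k} \<Longrightarrow> j < l \<Longrightarrow> part_pos k \<mu> l < part_pos k la j"
  using part_pos_strict[OF la, of j l] form_pos_out[of l] form_bounds by simp

lemma form_pos_notin: "part_pos k la j \<notin> part_set k \<mu>"
proof
  assume "part_pos k la j \<in> part_set k \<mu>"
  then obtain l where "l \<in> {1..k}" "part_pos k la j = part_pos k \<mu> l" by (auto simp: part_set_def)
  then show False using form_pos_less[of l] form_pos_greater[of l] by (cases "l \<le> j") auto
qed

lemma form_pos_range: "part_pos k la j \<in> {1..<part_pos k \<mu> i} - part_set k \<mu>"
  using form_pos_notin form_pos_less[of i] form_bounds by (auto simp: part_pos_def)

text \<open>Rows \<open>i\<close> to \<open>j - 1\<close> of \<open>la\<close> take over the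
  positions of rows \<open>i + 1\<close> to \<open>j\<close> of \<open>\<mu>\<close>. So the only
  position lost is that of row \<open>i\<close> in \<open>\<mu>\<close>, and the only new one is
  that of row \<open>j\<close> in \<open>la\<close>.\<close>

lemma form_part_set: "part_set k la = insert (part_pos k la j) (part_set k \<mu> - {part_pos k \<mu> i})"
proof -
  have "part_set k \<mu> - {part_pos k \<mu> i} = part_pos k \<mu> ` ({1..k} - {i})"
    unfolding part_set_def using inj_on_image_set_diff[OF part_pos_inj[OF mu], of "{1..k}" "{i}"]
      form_bounds by simp
  also have "{1..k} - {i} = ({1..<i} \<union> {Suc j..k}) \<union> Suc ` {i..<j}"
    using form_bounds by (auto simp: image_Suc_atLeastLessThan)
  also have "part_pos k \<mu> ` \<dots> = part_pos k la ` ({1..<i} \<union> {Suc j..k}) \<union> part_pos k la ` {i..<j}"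
  proof -
    have "part_pos k \<mu> ` ({1..<i} \<union> {Suc j..k}) = part_pos k la ` ({1..<i} \<union> {Suc j..k})"
      by (rule image_cong) (auto simp: form_pos_out)
    moreover have "part_pos k \<mu> ` Suc ` {i..<j} = part_pos k la ` {i..<j}"
      unfolding image_image by (rule image_cong) (auto simp: form_pos_shift)
    ultimately show ?thesis by (simp only: image_Un)
  qed
  also have "insert (part_pos k la j) \<dots> = part_pos k la ` (insert j ({1..<i} \<union> {Suc j..k} \<union> {i..<j}))"
    by (simp only: image_Un image_insert)
  also have "insert j ({1..<i} \<union> {Suc j..k} \<union> {i..<j}) = {1..k}" using form_bounds by auto
  finally show ?thesis unfolding part_set_def ..
qed

text \<open>The occupied places in the interval are the positions of rows \<open>i + 1\<close> to
  \<open>j\<close>; the holes are what remains of its length. These are the exponents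
  \<open>ht - 1\<close> and \<open>wd - 1\<close>.\<close>

lemma form_card_between:
  "card (part_set k \<mu> \<inter> {part_pos k la j<..<part_pos k \<mu> i}) = j - i"
  "card ({part_pos k la j<..<part_pos k \<mu> i} - part_set k \<mu>) = \<mu> i - la j - 1"
proof -
  let ?I = "{part_pos k la j<..<part_pos k \<mu> i}"
  have eq: "part_set k \<mu> \<inter> ?I = part_pos k \<mu> ` {Suc i..j}"
  proof
    show "part_set k \<mu> \<inter> ?I \<subseteq> part_pos k \<mu> ` {Suc i..j}"
    proof
      fix s assume "s \<in> part_set k \<mu> \<inter> ?I"
      then obtain l where l: "l \<in> {1..k}" "s = part_pos k \<mu> l"
        "part_pos k la j < s" "s < part_pos k \<mu> i" by (auto simp: part_set_def)
      have "l \<le> j" using form_pos_greater[OF l(1)] l by force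
      moreover have "i < l"
        using part_pos_strict[OF mu, of l i] l form_bounds by (cases l i rule: linorder_cases) auto
      ultimately show "s \<in> part_pos k \<mu> ` {Suc i..j}" using l by auto
    qed
    show "part_pos k \<mu> ` {Suc i..j} \<subseteq> part_set k \<mu> \<inter> ?I"
      using form_pos_less part_pos_strict[OF mu, of i] form_bounds by (force simp: part_set_def)
  qed
  have "inj_on (part_pos k \<mu>) {Suc i..j}"
    by (rule inj_on_subset[OF part_pos_inj[OF mu]]) (use form_bounds in auto)
  then show c: "card (part_set k \<mu> \<inter> ?I) = j - i" unfolding eq by (simp add: card_image)
  have "card (?I - part_set k \<mu>) = card ?I - card (part_set k \<mu> \<inter> ?I)"
    by (subst Int_commute) (simp add: card_Diff_subset_Int Int_commute)
  also have "\<dots> = \<mu> i - la j - 1"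
    unfolding c using form_less[of i] box_parts_antimono[OF la, of i j] form_bounds
    by (simp add: part_pos_def)
  finally show "card (?I - part_set k \<mu>) = \<mu> i - la j - 1" .
qed

end

text \<open>The ribbon ends in the last row \<open>j\<close> of \<open>\<mu>\<close> whose position
  exceeds \<open>t\<close>: the rows between shift up by one, and row \<open>j\<close> receives the
  position \<open>t\<close>.\<close>

lemma form_exists:
  assumes mu: "\<mu> \<in> box_parts n k" and i: "i \<in> {1..k}"
    and t: "t \<in> {1..<part_pos k \<mu> i} - part_set k \<mu>"
  shows "\<exists>la j. la \<in> box_parts n k \<and> ribbon_form k i j \<mu> la \<and> part_pos k la j = t"
proof -
  let ?J = "{l \<in> {1..k}. t < part_pos k \<mu> l}"
  define j where "j = Max ?J"
  have iJ: "i \<in> ?J" using i t by simp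
  have fin: "finite ?J" by simp
  have "j \<in> ?J" unfolding j_def using Max_in[OF fin] iJ by blast
  then have j: "1 \<le> j" "j \<le> k" "t < part_pos k \<mu> j" by auto
  have ij: "i \<le> j" unfolding j_def using Max_ge[OF fin iJ] .
  have above: "part_pos k \<mu> l < t" if "j < l" "l \<le> k" for l
  proof -
    have "l \<notin> ?J" using Max_ge[OF fin, of l] that unfolding j_def[symmetric] by auto
    moreover have "part_pos k \<mu> l \<noteq> t" using t that j by (auto simp: part_set_def)
    ultimately show ?thesis using that by auto
  qed
  \<comment> \<open>Ensures that the new part of row \<open>j\<close> is at least
    \<open>\<mu> (Suc j)\<close> and that the subtraction defining it is not truncated. For
    \<open>j = k\<close> this is just \<open>1 \<le> t\<close>.\<close>
  have t1: "\<mu> (Suc j) + (k + 1 - j) \<le> t"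
  proof (cases "j < k")
    case True
    then show ?thesis using above[of "Suc j"] by (simp add: part_pos_def)
  next
    case False
    then have "\<mu> (Suc j) = 0" using mu j by (simp add: box_parts_def)
    then show ?thesis using False j t by simp
  qed
  \<comment> \<open>The middle clause is forced by the one-column overlap, the last one by the
    required position \<open>t\<close>.\<close>
  define la where "la l = (if l < i \<or> j < l then \<mu> l else if l < j then \<mu> (Suc l) - 1 else t - (k + 1 - j))" for l
  have laj: "la j = t - (k + 1 - j)" using ij by (simp add: la_def)
  have lt: "la j < \<mu> j" using j t1 unfolding laj by (simp add: part_pos_def)
  have pos: "1 \<le> \<mu> (Suc l)" if "l < j" for l
    using box_parts_antimono[OF mu, of "Suc l" j] that lt by simp
  have anti: "\<mu> (Suc l) \<le> \<mu> l" if "1 \<le> l" for l using box_parts_antimono[OF mu that] by simp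
  have form: "ribbon_form k i j \<mu> la"
    unfolding ribbon_form_def using i j ij lt
  proof (intro conjI allI impI)
    fix l assume "i \<le> l \<and> l < j"
    then show "Suc (la l) = \<mu> (Suc l)" using pos[of l] by (simp add: la_def)
  qed (auto simp: la_def)
  have le: "la l \<le> \<mu> l" for l
  proof -
    consider "l < i \<or> j < l" | "i \<le> l" "l < j" | "l = j" by linarith
    then show ?thesis
    proof cases
      case 2
      then show ?thesis using anti[of l] i by (simp add: la_def)
    qed (use lt in \<open>auto simp: la_def\<close>)
  qed
  have "la \<in> box_parts n k"
    unfolding box_parts_def
  proof (intro CollectI conjI allI impI)
    fix l assume "l = 0 \<or> k < l"
    then show "la l = 0" using mu i j by (auto simp: la_def box_parts_def)
  next
    fix l
    show "la l \<le> n - k" using le[of l] mu by (auto simp: box_parts_def intro: le_trans)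
  next
    fix l assume l: "1 \<le> l \<and> l < k"
    consider "l < i \<or> j < l" | "i \<le> l" "Suc l < j" | "i \<le> l" "Suc l = j" | "l = j" by linarith
    then show "la (Suc l) \<le> la l"
    proof cases
      case 1
      then have "la l = \<mu> l" by (simp add: la_def)
      then show ?thesis using le[of "Suc l"] anti[of l] l by simp
    next
      case 2
      then have "la l = \<mu> (Suc l) - 1" "la (Suc l) = \<mu> (Suc (Suc l)) - 1" by (auto simp: la_def)
      then show ?thesis using anti[of "Suc l"] by simp
    next
      case 3
      then have "la l = \<mu> j - 1" by (auto simp: la_def)
      then show ?thesis using lt 3 by simp
    next
      case 4
      then have "la (Suc l) = \<mu> (Suc j)" by (simp add: la_def)
      then show ?thesis using t1 4 laj by simp
    qed
  qed
  moreover have "part_pos k la j = t"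
    using j t1 by (simp add: part_pos_def laj)
  ultimately show ?thesis using form by blast
qed

section \<open>The operators D_i\<close>

lemma sorted_list_of_set_insert_top:
  assumes "I \<subseteq> {1..m}"
  shows "sorted_list_of_set (insert (Suc m) I) = sorted_list_of_set I @ [Suc m]"
proof -
  have fin: "finite I" using assms by (rule finite_subset) simp
  have "sorted_wrt (<) (sorted_list_of_set I @ [Suc m])"
    using assms fin by (auto simp: sorted_wrt_append)
  then show ?thesis
  proof (rule strict_sorted_equal)
    show "sorted_wrt (<) (sorted_list_of_set (insert (Suc m) I))"
      by (rule sorted_list_of_set.strict_sorted_key_list_of_set)
    have "set (sorted_list_of_set (insert (Suc m) I)) = insert (Suc m) I"
      by (rule sorted_list_of_set.set_sorted_key_list_of_set) (use fin in simp)
    then show "set (sorted_list_of_set (insert (Suc m) I)) = set (sorted_list_of_set I @ [Suc m])"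
      using fin by simp
  qed
qed

text \<open>Stated for any function of the sorted list, so that it serves both the monomials and the
  operator products. The new index \<open>Suc m\<close> comes last in the list, that is, as
  innermost operator.\<close>

lemma sum_subsets_Suc:
  fixes \<phi> :: "nat list \<Rightarrow> 'a::comm_monoid_add"
  shows "(\<Sum>I\<in>{I. I \<subseteq> {1..Suc m} \<and> card I = r}. \<phi> (sorted_list_of_set I)) =
    (\<Sum>I\<in>{I. I \<subseteq> {1..m} \<and> card I = r}. \<phi> (sorted_list_of_set I)) +
    (case r of 0 \<Rightarrow> 0
     | Suc r' \<Rightarrow> \<Sum>I\<in>{I. I \<subseteq> {1..m} \<and> card I = r'}. \<phi> (sorted_list_of_set I @ [Suc m]))"
proof -
  let ?A = "\<lambda>(m::nat) r. {I. I \<subseteq> {1..m} \<and> card I = r}"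
  have fin: "finite I" if "I \<subseteq> {1..m}" for I :: "nat set" and m using that by (rule finite_subset) simp
  have finA: "finite (?A m r)" for m r :: nat by (rule finite_subset[of _ "Pow {1..m}"]) auto
  have Suc_iff: "I \<subseteq> {1..Suc m} \<and> Suc m \<notin> I \<longleftrightarrow> I \<subseteq> {1..m}" for I
    by (auto simp: subset_iff) (metis le_Suc_eq)
  show ?thesis
  proof (cases r)
    case 0
    have "?A m 0 = {{}}" for m
    proof (intro equalityI subsetI)
      fix I assume "I \<in> ?A m 0"
      then show "I \<in> {{}}" using fin[of I m] by simp
    qed simp
    then show ?thesis using 0 by simp
  next
    case (Suc r')
    have "?A (Suc m) r = ?A m r \<union> insert (Suc m) ` ?A m r'"
    proof (intro equalityI subsetI)
      fix I assume I: "I \<in> ?A (Suc m) r"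
      show "I \<in> ?A m r \<union> insert (Suc m) ` ?A m r'"
      proof (cases "Suc m \<in> I")
        case True
        then have "card (I - {Suc m}) = r'" using I Suc by simp
        moreover have "I - {Suc m} \<subseteq> {1..m}" using I Suc_iff[of "I - {Suc m}"] by auto
        ultimately have "insert (Suc m) (I - {Suc m}) \<in> insert (Suc m) ` ?A m r'" by blast
        then show ?thesis using True by (simp add: insert_absorb)
      next
        case False
        then show ?thesis using I Suc_iff[of I] by simp
      qed
    next
      fix I assume "I \<in> ?A m r \<union> insert (Suc m) ` ?A m r'"
      then show "I \<in> ?A (Suc m) r"
      proof
        assume "I \<in> ?A m r"
        then show ?thesis using Suc_iff[of I] by simp
      next
        assume "I \<in> insert (Suc m) ` ?A m r'"
        then obtain J where J: "J \<subseteq> {1..m}" "card J = r'" "I = insert (Suc m) J" by blast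
        have "Suc m \<notin> J" using J(1) by auto
        then have "card I = r" using J fin[OF J(1)] Suc by simp
        moreover have "I \<subseteq> {1..Suc m}" using J by auto
        ultimately show ?thesis by simp
      qed
    qed
    moreover have "?A m r \<inter> insert (Suc m) ` ?A m r' = {}" by auto
    moreover have "inj_on (insert (Suc m)) (?A m r')"
    proof (rule inj_onI)
      fix I J assume "I \<in> ?A m r'" "J \<in> ?A m r'" and eq: "insert (Suc m) I = insert (Suc m) J"
      then have "Suc m \<notin> I" "Suc m \<notin> J" using Suc_iff by blast+
      with eq show "I = J" by (metis insert_ident)
    qed
    ultimately have "(\<Sum>I\<in>?A (Suc m) r. \<phi> (sorted_list_of_set I)) =
        (\<Sum>I\<in>?A m r. \<phi> (sorted_list_of_set I)) +
        (\<Sum>I\<in>?A m r'. \<phi> (sorted_list_of_set (insert (Suc m) I)))"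
      using finA by (simp only: sum.union_disjoint finite_imageI sum.reindex o_def)
    also have "(\<Sum>I\<in>?A m r'. \<phi> (sorted_list_of_set (insert (Suc m) I))) =
        (\<Sum>I\<in>?A m r'. \<phi> (sorted_list_of_set I @ [Suc m]))"
      by (rule sum.cong[OF refl]) (simp only: mem_Collect_eq sorted_list_of_set_insert_top)
    finally show ?thesis using Suc by simp
  qed
qed

lemma sum_subsets_0:
  fixes \<phi> :: "nat list \<Rightarrow> 'a::comm_monoid_add"
  shows "(\<Sum>I\<in>{I. I \<subseteq> {1..0::nat} \<and> card I = r}. \<phi> (sorted_list_of_set I)) = (if r = 0 then \<phi> [] else 0)"
proof -
  have "{I. I \<subseteq> {1..0::nat} \<and> card I = r} = (if r = 0 then {{}} else {})" by auto
  then show ?thesis by simp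
qed

lemma sum_subsets_elem_sym:
  "(\<Sum>I\<in>{I. I \<subseteq> {1..m} \<and> card I = r}. prod_list (map x (sorted_list_of_set I)))
   = elem_sym x r [1..<Suc m]"
proof (induction m arbitrary: r)
  case 0
  show ?case unfolding sum_subsets_0[of "\<lambda>L. prod_list (map x L)"] by simp
next
  case (Suc m)
  have "[1..<Suc (Suc m)] = [1..<Suc m] @ [Suc m]" by simp
  then show ?case
    unfolding sum_subsets_Suc[of "\<lambda>L. prod_list (map x L)"] Suc.IH
    by (simp only: elem_sym_snoc map_append prod_list.append list.map prod_list.Cons prod_list.Nil
        mult_1_right sum_distrib_right[symmetric] Suc.IH)
qed

section \<open>Products of the operators \<open>D_i\<close> evaluated as sums over jumps\<close>

context hecke
begin

lemma TbarP_eq_P: "\<nu> \<in> box_parts n k \<Longrightarrow> TbarP n k p q T cinv \<nu> = P (part_set k \<nu>)"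
  by (simp add: TbarP_def P_def wperm_eq_grass_perm)

abbreviation ribbons :: "nat \<Rightarrow> (nat \<Rightarrow> nat) \<Rightarrow> (nat \<Rightarrow> nat) set" where
  "ribbons i \<mu> \<equiv> {la \<in> box_parts n k. is_ribbon \<mu> la \<and> head_row \<mu> la = i}"

definition ribbon_coeff :: "(nat \<Rightarrow> nat) \<Rightarrow> (nat \<Rightarrow> nat) \<Rightarrow> 'a" where
  "ribbon_coeff \<mu> la = (h - (p - q) * x (ribbon_h k \<mu> la)) *
     p ^ (ribbon_ht \<mu> la - 1) * q ^ (ribbon_wd \<mu> la - 1)"

text \<open>Ribbons with head in row \<open>i\<close> correspond to free places below the position
  of that row, by sending \<open>la\<close> to its one new position; height and width match the
  counts in \<open>wt\<close>.\<close>

lemma sum_ribbons: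
  assumes mu: "\<mu> \<in> box_parts n k" and i: "i \<in> {1..k}"
  shows "(\<Sum>la\<in>ribbons i \<mu>. ribbon_coeff \<mu> la * F (part_set k la)) =
    xfac (part_pos k \<mu> i) * jump (part_pos k \<mu> i) F (part_set k \<mu>)"
proof -
  let ?s = "part_pos k \<mu> i" and ?S = "part_set k \<mu>"
  \<comment> \<open>By \<open>form_part_set\<close> the difference is a singleton, namely the
    position where the particle lands.\<close>
  let ?t = "\<lambda>la. the_elem (part_set k la - ?S)"
  let ?B = "{1..<?s} - ?S"
  have ribD: "\<exists>j. ribbon_form k i j \<mu> la" if "la \<in> ribbons i \<mu>" for la
    using ribbon_imp_form[OF mu, of la] that by auto
  have t: "?t la = part_pos k la j" if "la \<in> box_parts n k" "ribbon_form k i j \<mu> la" for la j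
  proof -
    have "part_set k la - ?S = {part_pos k la j}"
      unfolding form_part_set[OF mu that] using form_pos_notin[OF mu that] by auto
    then show ?thesis by simp
  qed
  have set_la: "part_set k la = insert (?t la) (?S - {?s})" if la: "la \<in> ribbons i \<mu>" for la
  proof -
    obtain j where j: "ribbon_form k i j \<mu> la" using ribD[OF la] ..
    have "la \<in> box_parts n k" using la by simp
    from form_part_set[OF mu this j] t[OF this j] show ?thesis by simp
  qed
  have "bij_betw ?t (ribbons i \<mu>) ?B"
    unfolding bij_betw_def
  proof
    show "inj_on ?t (ribbons i \<mu>)"
    proof (rule inj_onI)
      fix la la' assume A: "la \<in> ribbons i \<mu>" "la' \<in> ribbons i \<mu>" and eq: "?t la = ?t la'"
      have "part_set k la = insert (?t la) (?S - {?s})" by (rule set_la[OF A(1)])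
      also have "\<dots> = insert (?t la') (?S - {?s})" by (simp only: eq)
      also have "\<dots> = part_set k la'" by (rule set_la[OF A(2), symmetric])
      finally show "la = la'" by (rule part_set_inj[of la n k la', rotated 2]) (use A in simp_all)
    qed
    show "?t ` ribbons i \<mu> = ?B"
    proof (intro equalityI subsetI)
      fix u assume "u \<in> ?t ` ribbons i \<mu>"
      then obtain la where la: "la \<in> ribbons i \<mu>" "u = ?t la" by (rule imageE)
      obtain j where j: "ribbon_form k i j \<mu> la" using ribD[OF la(1)] ..
      have "la \<in> box_parts n k" using la(1) by simp
      from form_pos_range[OF mu this j] t[OF this j] la(2) show "u \<in> ?B" by simp
    next
      fix u assume "u \<in> ?B"
      from form_exists[OF mu i this] obtain la j
        where la: "la \<in> box_parts n k" and j: "ribbon_form k i j \<mu> la" and u: "part_pos k la j = u"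
        by blast
      have rib: "la \<in> ribbons i \<mu>"
        using la form_is_ribbon[OF mu la j] form_head_row[OF mu la j] by simp
      have "u = ?t la" using t[OF la j] u by simp
      then show "u \<in> ?t ` ribbons i \<mu>" by (rule image_eqI[OF _ rib])
    qed
  qed
  note bij = sum.reindex_bij_betw[OF this]
  have summand: "ribbon_coeff \<mu> la * F (part_set k la) =
      xfac ?s * (wt ?S ?s (?t la) * F (insert (?t la) (?S - {?s})))" if la: "la \<in> ribbons i \<mu>" for la
  proof -
    obtain j where j: "ribbon_form k i j \<mu> la" using ribD[OF la] ..
    have lab: "la \<in> box_parts n k" using la by simp
    have "ribbon_h k \<mu> la = ?s"
      unfolding ribbon_h_def form_head_row[OF mu lab j] part_pos_def ..
    then have "ribbon_coeff \<mu> la = xfac ?s * wt ?S ?s (?t la)"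
      unfolding ribbon_coeff_def wt_def t[OF lab j] form_card_between[OF mu lab j]
        form_ht[OF mu lab j] form_wd[OF mu lab j] xfac_def
      by (simp only: mult.assoc)
    then show ?thesis unfolding set_la[OF la, symmetric] by (simp only: mult.assoc)
  qed
  have "(\<Sum>la\<in>ribbons i \<mu>. ribbon_coeff \<mu> la * F (part_set k la)) =
      (\<Sum>la\<in>ribbons i \<mu>. xfac ?s * (wt ?S ?s (?t la) * F (insert (?t la) (?S - {?s}))))"
    by (rule sum.cong[OF refl summand])
  also have "\<dots> = (\<Sum>u\<in>?B. xfac ?s * (wt ?S ?s u * F (insert u (?S - {?s}))))"
    by (rule bij)
  finally show ?thesis by (simp only: jump_def sum_distrib_left)
qed

abbreviation single :: "(nat \<Rightarrow> nat) \<Rightarrow> (nat \<Rightarrow> nat) \<Rightarrow> 'a" where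
  "single \<mu> \<equiv> \<lambda>\<nu>. if \<nu> = \<mu> then 1 else 0"

definition apply_D :: "nat list \<Rightarrow> ((nat \<Rightarrow> nat) \<Rightarrow> 'a) \<Rightarrow> 'a" where
  "apply_D L c = evalP n k p q T cinv (foldr (Dop n k p q h x) L c)"

text \<open>Matrix entry of \<open>D_i\<close>: the coefficient at \<open>la\<close> of its value on
  the basis symbol \<open>\<mu>\<close>.\<close>

definition Dcoeff :: "nat \<Rightarrow> (nat \<Rightarrow> nat) \<Rightarrow> (nat \<Rightarrow> nat) \<Rightarrow> 'a" where
  "Dcoeff i \<mu> la = (if \<mu> = la then x (part_pos k la i) else 0) +
     (if is_ribbon \<mu> la \<and> head_row \<mu> la = i then ribbon_coeff \<mu> la else 0)"

lemma Dop_eq: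
  assumes "la \<in> box_parts n k"
  shows "Dop n k p q h x i c la = (\<Sum>\<mu>\<in>box_parts n k. c \<mu> * Dcoeff i \<mu> la)"
proof -
  have "(\<Sum>\<mu>\<in>box_parts n k. c \<mu> * Dcoeff i \<mu> la) =
      (\<Sum>\<mu>\<in>box_parts n k. if \<mu> = la then c \<mu> * x (part_pos k la i) else 0) +
      (\<Sum>\<mu>\<in>box_parts n k. if is_ribbon \<mu> la \<and> head_row \<mu> la = i then c \<mu> * ribbon_coeff \<mu> la else 0)"
    unfolding sum.distrib[symmetric] by (rule sum.cong) (auto simp: Dcoeff_def distrib_left)
  also have "(\<Sum>\<mu>\<in>box_parts n k. if \<mu> = la then c \<mu> * x (part_pos k la i) else 0) =
      c la * x (part_pos k la i)"
    using assms finite_box_parts by (simp add: sum.delta)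
  finally show ?thesis
    unfolding Dop_def part_pos_def ribbon_coeff_def
    by (simp only: sum.inter_filter[OF finite_box_parts])
qed

lemma Dop_single:
  assumes "la \<in> box_parts n k" "\<mu> \<in> box_parts n k"
  shows "Dop n k p q h x i (single \<mu>) la = Dcoeff i \<mu> la"
proof -
  have "Dop n k p q h x i (single \<mu>) la = (\<Sum>\<nu>\<in>box_parts n k. if \<nu> = \<mu> then Dcoeff i \<nu> la else 0)"
    unfolding Dop_eq[OF assms(1)] by (rule sum.cong) auto
  then show ?thesis using assms(2) finite_box_parts by (simp add: sum.delta)
qed

lemma apply_D_Nil:
  assumes "\<mu> \<in> box_parts n k"
  shows "apply_D [] (single \<mu>) = TbarP n k p q T cinv \<mu>"
proof -
  have "apply_D [] (single \<mu>) =
      (\<Sum>\<nu>\<in>box_parts n k. if \<nu> = \<mu> then TbarP n k p q T cinv \<nu> else 0)"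
    unfolding apply_D_def evalP_def by (rule sum.cong) auto
  then show ?thesis using assms finite_box_parts by (simp add: sum.delta)
qed

lemma apply_D_snoc: "apply_D (L @ [i]) c = apply_D L (Dop n k p q h x i c)"
  by (simp add: apply_D_def)

text \<open>Coefficients stay on the left under every \<open>D_i\<close>. The induction removes the
  last list element, the operator applied first to \<open>c\<close>.\<close>

lemma apply_D_linear: "apply_D L c = (\<Sum>\<mu>\<in>box_parts n k. c \<mu> * apply_D L (single \<mu>))"
proof (induction L arbitrary: c rule: rev_induct)
  case Nil
  show ?case using apply_D_Nil by (simp add: apply_D_def evalP_def)
next
  case (snoc i L)
  have one: "apply_D (L @ [i]) (single \<mu>) =
      (\<Sum>la\<in>box_parts n k. Dcoeff i \<mu> la * apply_D L (single la))" if "\<mu> \<in> box_parts n k" for \<mu>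
    unfolding apply_D_snoc by (subst snoc.IH) (rule sum.cong, simp_all only: Dop_single that)
  have "apply_D (L @ [i]) c =
      (\<Sum>la\<in>box_parts n k. (\<Sum>\<mu>\<in>box_parts n k. c \<mu> * Dcoeff i \<mu> la) * apply_D L (single la))"
    unfolding apply_D_snoc by (subst snoc.IH) (rule sum.cong, simp_all only: Dop_eq)
  also have "\<dots> = (\<Sum>la\<in>box_parts n k. \<Sum>\<mu>\<in>box_parts n k. c \<mu> * (Dcoeff i \<mu> la * apply_D L (single la)))"
    by (simp only: sum_distrib_right mult.assoc)
  also have "\<dots> = (\<Sum>\<mu>\<in>box_parts n k. \<Sum>la\<in>box_parts n k. c \<mu> * (Dcoeff i \<mu> la * apply_D L (single la)))"
    by (rule sum.swap)
  also have "\<dots> = (\<Sum>\<mu>\<in>box_parts n k. c \<mu> * apply_D (L @ [i]) (single \<mu>))"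
    by (rule sum.cong[OF refl]) (simp only: one sum_distrib_left)
  finally show ?case .
qed

text \<open>\<open>Dop\<close> sums over sources for a fixed target; linearity turns this into the
  sum over targets \<open>la\<close> for the fixed source \<open>\<mu>\<close>.\<close>

lemma apply_D_snoc_single:
  assumes "\<mu> \<in> box_parts n k"
  shows "apply_D (L @ [i]) (single \<mu>) =
    x (part_pos k \<mu> i) * apply_D L (single \<mu>) +
    (\<Sum>la\<in>ribbons i \<mu>. ribbon_coeff \<mu> la * apply_D L (single la))"
proof -
  have "apply_D (L @ [i]) (single \<mu>) =
      (\<Sum>la\<in>box_parts n k. Dop n k p q h x i (single \<mu>) la * apply_D L (single la))"
    unfolding apply_D_snoc by (rule apply_D_linear)
  also have "\<dots> = (\<Sum>la\<in>box_parts n k. Dcoeff i \<mu> la * apply_D L (single la))"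
    by (rule sum.cong[OF refl]) (simp only: Dop_single assms)
  also have "\<dots> = (\<Sum>la\<in>box_parts n k. if \<mu> = la then x (part_pos k la i) * apply_D L (single la) else 0) +
      (\<Sum>la\<in>box_parts n k.
        if is_ribbon \<mu> la \<and> head_row \<mu> la = i then ribbon_coeff \<mu> la * apply_D L (single la) else 0)"
    unfolding sum.distrib[symmetric] by (rule sum.cong) (auto simp: Dcoeff_def distrib_right)
  also have "(\<Sum>la\<in>box_parts n k. if \<mu> = la then x (part_pos k la i) * apply_D L (single la) else 0) =
      x (part_pos k \<mu> i) * apply_D L (single \<mu>)"
    using assms finite_box_parts by (simp add: sum.delta')
  finally show ?thesis by (simp only: sum.inter_filter[OF finite_box_parts])
qed

text \<open>If row \<open>Suc m\<close> is selected, its operator is innermost and acts on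
  \<open>\<mu>\<close> directly, which gives the stay and jump terms of \<open>expand\<close>. The
  induction covers all partitions because the remaining operators act on the results.\<close>

lemma sum_apply_D_eq_expand:
  assumes "\<mu> \<in> box_parts n k" "m \<le> k"
  shows "(\<Sum>I\<in>{I. I \<subseteq> {1..m} \<and> card I = r}. apply_D (sorted_list_of_set I) (single \<mu>)) =
    expand r (map (part_pos k \<mu>) (rev [1..<Suc m])) (part_set k \<mu>)"
  using assms
proof (induction m arbitrary: r \<mu>)
  case 0
  have "apply_D [] (single \<mu>) = P (part_set k \<mu>)"
    using 0(1) by (simp add: apply_D_Nil TbarP_eq_P)
  then show ?case
    unfolding sum_subsets_0[of "\<lambda>L. apply_D L (single \<mu>)"] by simp
next
  case (Suc m)
  let ?H = "\<lambda>r \<mu>. \<Sum>I\<in>{I. I \<subseteq> {1..m} \<and> card I = r}. apply_D (sorted_list_of_set I) (single \<mu>)"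
  let ?L = "map (part_pos k \<mu>) (rev [1..<Suc m])" and ?s = "part_pos k \<mu> (Suc m)"
  have IH: "?H r' la = expand r' (map (part_pos k la) (rev [1..<Suc m])) (part_set k la)"
    if "la \<in> box_parts n k" for r' la
    using Suc.IH[OF that] Suc.prems(2) by simp
  \<comment> \<open>A ribbon with head in row \<open>Suc m\<close> leaves rows \<open>1\<close> to
    \<open>m\<close> untouched, so the list of positions still to be treated does not depend on
    \<open>la\<close>.\<close>
  have same: "map (part_pos k la) (rev [1..<Suc m]) = ?L" if la: "la \<in> ribbons (Suc m) \<mu>" for la
  proof -
    obtain j where j: "ribbon_form k (Suc m) j \<mu> la"
      using ribbon_imp_form[OF Suc.prems(1), of la] la by auto
    have "la \<in> box_parts n k" using la by simp
    from form_pos_out[OF Suc.prems(1) this j] show ?thesis by (auto simp del: upt_Suc)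
  qed
  have step: "(\<Sum>I\<in>{I. I \<subseteq> {1..m} \<and> card I = r'}. apply_D (sorted_list_of_set I @ [Suc m]) (single \<mu>)) =
      x ?s * expand r' ?L (part_set k \<mu>) + xfac ?s * jump ?s (expand r' ?L) (part_set k \<mu>)" for r'
  proof -
    have "(\<Sum>I\<in>{I. I \<subseteq> {1..m} \<and> card I = r'}. apply_D (sorted_list_of_set I @ [Suc m]) (single \<mu>)) =
        x ?s * ?H r' \<mu> + (\<Sum>la\<in>ribbons (Suc m) \<mu>. ribbon_coeff \<mu> la * ?H r' la)"
      unfolding apply_D_snoc_single[OF Suc.prems(1)] sum.distrib sum_distrib_left
      by (subst sum.swap) (rule refl)
    also have "(\<Sum>la\<in>ribbons (Suc m) \<mu>. ribbon_coeff \<mu> la * ?H r' la) =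
        (\<Sum>la\<in>ribbons (Suc m) \<mu>. ribbon_coeff \<mu> la * expand r' ?L (part_set k la))"
    proof (rule sum.cong[OF refl])
      fix la assume la: "la \<in> ribbons (Suc m) \<mu>"
      then have "la \<in> box_parts n k" by simp
      from IH[OF this] show "ribbon_coeff \<mu> la * ?H r' la = ribbon_coeff \<mu> la * expand r' ?L (part_set k la)"
        unfolding same[OF la] by (rule arg_cong)
    qed
    also have "\<dots> = xfac ?s * jump ?s (expand r' ?L) (part_set k \<mu>)"
      by (rule sum_ribbons[OF Suc.prems(1)]) (use Suc.prems(2) in simp)
    finally show ?thesis unfolding IH[OF Suc.prems(1)] .
  qed
  have L: "map (part_pos k \<mu>) (rev [1..<Suc (Suc m)]) = ?s # ?L" by simp
  show ?case
    unfolding L expand.simps sum_subsets_Suc[of "\<lambda>L. apply_D L (single \<mu>)"] step IH[OF Suc.prems(1)] ..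
qed

end

theorem theorem5p2:
  fixes n k r :: nat and p q h cinv :: "'a::ring_1"
    and T x :: "nat \<Rightarrow> 'a" and \<mu> :: "nat \<Rightarrow> nat"
  assumes "\<forall>m::int. m \<noteq> 0 \<longrightarrow> (\<exists>y::'a. of_int m * y = 1 \<and> y * of_int m = 1)"
    and "hecke_rels n p q h T x"
    and "cinv * (qfact p q k * qfact p q (n - k)) = 1"
    and "(qfact p q k * qfact p q (n - k)) * cinv = 1"
    and "k \<le> n" and "r \<le> k"
    and "\<mu> \<in> box_parts n k"
  shows "TbarP n k p q T cinv \<mu> *
           (\<Sum>I\<in>{I. I \<subseteq> {1..k} \<and> card I = r}. prod_list (map x (sorted_list_of_set I)))
         = (\<Sum>I\<in>{I. I \<subseteq> {1..k} \<and> card I = r}.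
              evalP n k p q T cinv
                (foldr (Dop n k p q h x) (sorted_list_of_set I) (\<lambda>\<nu>. if \<nu> = \<mu> then 1 else 0)))"
proof -
  interpret hecke n k p q h cinv T x using assms(2-5) by unfold_locales
  show ?thesis
    unfolding TbarP_eq_P[OF assms(7)] sum_subsets_elem_sym apply_D_def[symmetric]
      sum_apply_D_eq_expand[OF assms(7) order.refl] sorted_part_set[OF assms(7)]
    by (rule P_elem_sym[OF part_set_subset[OF assms(7,5)] part_set_card[OF assms(7)]])
qed

end
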